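(* For every primitive $p$-tuple $a=(a_1,\dots,a_p)$, with $r(a):=\sum_{\mu\in\mathbb{Z}_+^p,\ \mu\leq\lambda}\mathrm{F}(a^\lambda_\mu)$, where $\lambda=(\lambda_1,\dots,\lambda_p)$ is given by $\lambda_i:=\max(a)$ for every $i$, there is an algorithm that, given any independence system $S\subseteq\{0,1\}^n$ presented by a linear-optimization oracle, weight vector $w\in\{a_1,\dots,a_p\}^n$, and function $f:\mathbb{Z}\rightarrow\mathbb{R}$ presented by a comparison oracle, provides an $r(a)$-best solution to the nonlinear problem $\min\{f(wx) : x\in S\}$, in time polynomial in $n$. Moreover: 1. If $a_i$ divides $a_{i+1}$ for $i=1,\dots,p-1$, then the algorithm provides an optimal solution. 2. For $p=2$, that is, for $a=(a_1,a_2)$, the algorithm provides an $\mathrm{F}(a)$-best solution.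
   Context: A $p$-tuple $a=(a_1,\dots,a_p)$ is primitive if the $a_i$ are distinct positive integers with $\gcd(a_1,\dots,a_p)=1$; $\max(a):=\max\{a_1,\dots,a_p\}$; $\mathbb{Z}_+$ denotes the nonnegative integers; inequalities between vectors are componentwise. The Frobenius number $\mathrm{F}(a)$ of a primitive tuple $a$ with all $a_i\ge 2$ is the largest integer not expressible as a nonnegative integer combination of the $a_i$; if some $a_i=1$ then $\mathrm{F}(a):=0$ by convention, and $\mathrm{F}(()):=0$ for the empty tuple. For $\lambda$ with $\lambda_i=\max(a)$ for all $i$ and $\mu\in\mathbb{Z}_+^p$ with $\mu\le\lambda$, define $I^\lambda_\mu:=\{i : \mu_i=\lambda_i\}$ and the (primitive or empty) tuple $a^\lambda_\mu:=\left(\frac{a_i}{\gcd(a_k : k\in I^\lambda_\mu)} : i\in I^\lambda_\mu\right)$. An independence system is a nonempty set $S\subseteq\{0,1\}^n$ such that $x\in\{0,1\}^n$ and $x\le y\in S$ imply $x\in S$. For $v\in\mathbb{Z}^n$ and $x\in\{0,1\}^n$, $vx:=\sum_{j=1}^n v_jx_j$. A linear-optimization oracle for $S$, queried on $v\in\mathbb{Z}^n$, returns an element $x\in S$ maximizing $vx$ over $S$. A comparison oracle for $f$, queried on $x,y\in\mathbb{Z}$, asserts whether or not $f(x)\le f(y)$. Running time is measured in the usual oracle model, each oracle query counting as one step; the tuple $a$ is fixed and is not part of the input. For a nonnegative integer $r$, a point $x^*\in S$ is an $r$-best solution if $|\{f(wx) : f(wx)<f(wx^* ),\ x\in S\}|\le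 r$; a $0$-best solution is the same as an optimal solution. *)

theory Defs
  imports "Jordan_Normal_Form.Matrix" "HOL-Computational_Algebra.Polynomial"
begin

section \<open>Primitive tuples and Frobenius numbers\<close>

text \<open>A tuple is a list; its length is p, and its entries are indexed from 0. The empty tuple is not
  primitive, since \<^term>\<open>Gcd {} = (0::nat)\<close>.\<close>

definition primitive_tuple :: "nat list \<Rightarrow> bool" where
  "primitive_tuple a \<longleftrightarrow> distinct a \<and> (\<forall>x\<in>set a. x > 0) \<and> Gcd (set a) = 1"

definition representable :: "nat list \<Rightarrow> nat \<Rightarrow> bool" where
  "representable a k \<longleftrightarrow> (\<exists>c :: nat \<Rightarrow> nat. k = (\<Sum>i<length a. c i * a ! i))"

text \<open>If all entries are at least 2, then 1 is not representable, so the largest integer that is not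
  representable is a natural number. It exists when the tuple is primitive; the definition
  is used for primitive and empty tuples only.\<close>

definition frobenius :: "nat list \<Rightarrow> nat" where
  "frobenius a = (if a = [] \<or> 1 \<in> set a then 0 else (GREATEST k. \<not> representable a k))"

definition active_set :: "nat list \<Rightarrow> nat list \<Rightarrow> nat set" where
  "active_set lam \<mu> = {i. i < length lam \<and> \<mu> ! i = lam ! i}"

definition active_tuple :: "nat list \<Rightarrow> nat list \<Rightarrow> nat list \<Rightarrow> nat list" where
  "active_tuple a lam \<mu> =
     map (\<lambda>i. a ! i div (GCD k\<in>active_set lam \<mu>. a ! k))
         (filter (\<lambda>i. i \<in> active_set lam \<mu>) [0..<length a])"

definition max_vector :: "nat list \<Rightarrow> nat list" where
  "max_vector a = replicate (length a) (Max (set a))"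

text \<open>\<^term>\<open>list_all2 (\<le>)\<close> is the componentwise order on lists of equal length, so that the sum has
  finitely many terms.\<close>

definition r_value :: "nat list \<Rightarrow> nat" where
  "r_value a = (\<Sum>\<mu> | list_all2 (\<le>) \<mu> (max_vector a). frobenius (active_tuple a (max_vector a) \<mu>))"

section \<open>The optimization problem and its oracles\<close>

definition zero_one_vecs :: "nat \<Rightarrow> int vec set" where
  "zero_one_vecs n = {x \<in> carrier_vec n. \<forall>j<n. x $ j \<in> {0, 1}}"

definition independence_system :: "nat \<Rightarrow> int vec set \<Rightarrow> bool" where
  "independence_system n S \<longleftrightarrow> S \<noteq> {} \<and> S \<subseteq> zero_one_vecs n \<and>
     (\<forall>y\<in>S. \<forall>x\<in>zero_one_vecs n. x \<le> y \<longrightarrow> x \<in> S)"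

text \<open>A linear-optimization oracle is an arbitrary function that picks one of the maximizers.\<close>

definition linear_optimization_oracle :: "nat \<Rightarrow> int vec set \<Rightarrow> (int vec \<Rightarrow> int vec) \<Rightarrow> bool" where
  "linear_optimization_oracle n S lin \<longleftrightarrow>
     (\<forall>v\<in>carrier_vec n. lin v \<in> S \<and> (\<forall>x\<in>S. v \<bullet> x \<le> v \<bullet> lin v))"

definition comparison_oracle :: "(int \<Rightarrow> real) \<Rightarrow> int \<Rightarrow> int \<Rightarrow> bool" where
  "comparison_oracle f x y \<longleftrightarrow> f x \<le> f y"

definition r_best :: "nat \<Rightarrow> int vec set \<Rightarrow> int vec \<Rightarrow> (int \<Rightarrow> real) \<Rightarrow> int vec \<Rightarrow> bool" where
  "r_best r S w f x' \<longleftrightarrow>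
     x' \<in> S \<and> card {f (w \<bullet> x) | x. x \<in> S \<and> f (w \<bullet> x) < f (w \<bullet> x')} \<le> r"

definition optimal_solution :: "int vec set \<Rightarrow> int vec \<Rightarrow> (int \<Rightarrow> real) \<Rightarrow> int vec \<Rightarrow> bool" where
  "optimal_solution S w f x' \<longleftrightarrow> x' \<in> S \<and> (\<forall>x\<in>S. f (w \<bullet> x') \<le> f (w \<bullet> x))"

section \<open>Algorithms\<close>

text \<open>Algorithms are programs for a unit-cost random access machine with structured control flow,
  equipped with one instruction for each of the two oracles. The store consists of integer variables and
  integer arrays, finitely many of each being mentioned by a program; array entries are addressed
  by computed indices. As addition and subtraction are the only arithmetic operations,
  a run of t steps only handles numbers whose bit length is linear in t plus the bit length of the
  input, so polynomial time on this machine is the same as polynomial time on Turing machines.\<close>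

type_synonym name = string

datatype aexp =
    Const int
  | Var name
  | Entry name aexp
  | Plus aexp aexp
  | Minus aexp aexp

datatype bexp =
    Leq aexp aexp
  | Neg bexp
  | Conj bexp bexp

datatype com =
    Skip
  | Assign name aexp
  | Store name aexp aexp      \<comment> \<open>array, index, value\<close>
  | Seq com com
  | If bexp com com
  | While bexp com
  | LinOpt name name          \<comment> \<open>query array, answer array\<close>
  | Compare name aexp aexp    \<comment> \<open>answer variable, query\<close>

datatype state = State (vars: "name \<Rightarrow> int") (arrays: "name \<Rightarrow> int \<Rightarrow> int")

fun aval :: "aexp \<Rightarrow> state \<Rightarrow> int" where
  "aval (Const c) s = c"
| "aval (Var x) s = vars s x"
| "aval (Entry A e) s = arrays s A (aval e s)"
| "aval (Plus e1 e2) s = aval e1 s + aval e2 s"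
| "aval (Minus e1 e2) s = aval e1 s - aval e2 s"

fun bval :: "bexp \<Rightarrow> state \<Rightarrow> bool" where
  "bval (Leq e1 e2) s \<longleftrightarrow> aval e1 s \<le> aval e2 s"
| "bval (Neg b) s \<longleftrightarrow> \<not> bval b s"
| "bval (Conj b1 b2) s \<longleftrightarrow> bval b1 s \<and> bval b2 s"

definition set_var :: "name \<Rightarrow> int \<Rightarrow> state \<Rightarrow> state" where
  "set_var x c s = State ((vars s)(x := c)) (arrays s)"

definition set_array :: "name \<Rightarrow> (int \<Rightarrow> int) \<Rightarrow> state \<Rightarrow> state" where
  "set_array A g s = State (vars s) ((arrays s)(A := g))"

definition get_vec :: "nat \<Rightarrow> name \<Rightarrow> state \<Rightarrow> int vec" where
  "get_vec n A s = vec n (\<lambda>j. arrays s A (int j))"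

definition put_vec :: "nat \<Rightarrow> name \<Rightarrow> int vec \<Rightarrow> state \<Rightarrow> state" where
  "put_vec n A v s =
     set_array A (\<lambda>i. if 0 \<le> i \<and> i < int n then v $ nat i else arrays s A i) s"

text \<open>\<open>run n lin cmp c s k s'\<close>: started in \<open>s\<close>, program \<open>c\<close> terminates in \<open>s'\<close> after \<open>k\<close> steps. The
  expressions occurring in a program have fixed size, so evaluating one is a bounded amount of work
  and is covered by the step of the instruction that contains it.\<close>

inductive run ::
  "nat \<Rightarrow> (int vec \<Rightarrow> int vec) \<Rightarrow> (int \<Rightarrow> int \<Rightarrow> bool) \<Rightarrow> com \<Rightarrow> state \<Rightarrow> nat \<Rightarrow> state \<Rightarrow> bool"
  for n :: nat and lin :: "int vec \<Rightarrow> int vec" and cmp :: "int \<Rightarrow> int \<Rightarrow> bool" where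
  Skip: "run n lin cmp Skip s 1 s"
| Assign: "run n lin cmp (Assign x e) s 1 (set_var x (aval e s) s)"
| Store: "run n lin cmp (Store A i e) s 1
            (set_array A ((arrays s A)(aval i s := aval e s)) s)"
| Seq: "run n lin cmp c1 s k1 s' \<Longrightarrow> run n lin cmp c2 s' k2 s'' \<Longrightarrow>
          run n lin cmp (Seq c1 c2) s (k1 + k2) s''"
| IfTrue: "bval b s \<Longrightarrow> run n lin cmp c1 s k s' \<Longrightarrow> run n lin cmp (If b c1 c2) s (1 + k) s'"
| IfFalse: "\<not> bval b s \<Longrightarrow> run n lin cmp c2 s k s' \<Longrightarrow> run n lin cmp (If b c1 c2) s (1 + k) s'"
| WhileFalse: "\<not> bval b s \<Longrightarrow> run n lin cmp (While b c) s 1 s"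
| WhileTrue: "bval b s \<Longrightarrow> run n lin cmp c s k1 s' \<Longrightarrow> run n lin cmp (While b c) s' k2 s'' \<Longrightarrow>
                run n lin cmp (While b c) s (1 + k1 + k2) s''"
| LinOpt: "run n lin cmp (LinOpt A B) s 1 (put_vec n B (lin (get_vec n A s)) s)"
| Compare: "run n lin cmp (Compare x e1 e2) s 1
              (set_var x (if cmp (aval e1 s) (aval e2 s) then 1 else 0) s)"

text \<open>The input is the number n in variable \<open>n\<close> and the weights in array \<open>w\<close>; everything else is
  initially 0. In particular, the system S and the function f are accessible through the oracles only.
  The output is read off array \<open>x\<close>.\<close>

definition input_state :: "nat \<Rightarrow> int vec \<Rightarrow> state" where
  "input_state n w = put_vec n ''w'' w (set_var ''n'' (int n) (State (\<lambda>_. 0) (\<lambda>_ _. 0)))"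

definition output_vec :: "nat \<Rightarrow> state \<Rightarrow> int vec" where
  "output_vec n s = get_vec n ''x'' s"

text \<open>Execution is deterministic, so the existence of a run says how the program behaves.\<close>

inductive_cases runE:
  "run n lin cmp Skip s k s'"
  "run n lin cmp (Assign x e) s k s'"
  "run n lin cmp (Store A i e) s k s'"
  "run n lin cmp (Seq c1 c2) s k s'"
  "run n lin cmp (If b c1 c2) s k s'"
  "run n lin cmp (While b c) s k s'"
  "run n lin cmp (LinOpt A B) s k s'"
  "run n lin cmp (Compare x e1 e2) s k s'"

lemma run_deterministic:
  "run n lin cmp c s k s' \<Longrightarrow> run n lin cmp c s l t \<Longrightarrow> l = k \<and> t = s'"
proof (induction arbitrary: l t rule: run.induct)
  case (Seq c1 s k1 s' c2 k2 s'')
  show ?case by (rule runE(4)[OF Seq.prems]) (use Seq.IH in \<open>(simp; blast)\<close>)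
next
  case (IfTrue b s c1 k s' c2)
  show ?case by (rule runE(5)[OF IfTrue.prems]) (use IfTrue.IH IfTrue.hyps(1) in \<open>(simp; blast)\<close>)+
next
  case (IfFalse b s c2 k s' c1)
  show ?case by (rule runE(5)[OF IfFalse.prems]) (use IfFalse.IH IfFalse.hyps(1) in \<open>(simp; blast)\<close>)+
next
  case (WhileFalse b s c)
  show ?case by (rule runE(6)[OF WhileFalse.prems]) (use WhileFalse.hyps in \<open>(simp; blast)\<close>)+
next
  case (WhileTrue b s c k1 s' k2 s'')
  show ?case by (rule runE(6)[OF WhileTrue.prems]) (use WhileTrue.IH WhileTrue.hyps(1) in \<open>(simp; blast)\<close>)+
next
  case Skip then show ?case by (rule runE(1)) simp
next
  case Assign then show ?case by (rule runE(2)) simp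
next
  case Store then show ?case by (rule runE(3)) simp
next
  case LinOpt then show ?case by (rule runE(7)) simp
next
  case Compare then show ?case by (rule runE(8)) simp
qed

end

theory Submission
  imports Defs
begin

text \<open>
  Let \<open>m\<close> be the largest entry of \<open>a\<close>. The type of a feasible set records for every weight value the
  number of elements with this weight, counted up to \<open>m\<close>; the values at which the count reaches \<open>m\<close>
  are active. For a fixed \<open>a\<close>, a set \<open>T\<close> of at most \<open>m\<close> elements per weight value and a set \<open>I\<close> of
  active values can be guessed in polynomially many ways. For each guess, one query to the
  linear-optimization oracle, with a large bonus on \<open>T\<close>, the true weights on the active values and 0
  elsewhere, returns a feasible set. If \<open>T\<close> is part of some feasible set, then the answer contains
  \<open>T\<close>, and it is as heavy as possible on the other elements of active value. By independence, all of its
  subsets are feasible; the program tries subsets of it that realize all possible numbers of elements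
  of active value together with the elements of \<open>T\<close> of inactive value. It keeps the best of all these
  candidates with the comparison oracle.

  It remains to count the weights that feasible sets have and no candidate has. Consider one type, with
  active values \<open>I\<close>, and a guess \<open>T\<close> taken from a heaviest feasible set of this type. The inactive
  values contribute the same amount to all feasible sets of the type, and the candidates of
  this guess contribute on top of it all sums that are payable from a supply \<open>L x \<ge> m\<close> of coins of each
  value \<open>x \<in> I\<close>. Such a supply is saturated (\<open>bounded_representation\<close>): it pays every amount that is a
  nonnegative combination of \<open>I\<close> and whose complement in the whole supply is one, too. The weight of a
  feasible set gives such a combination, so it is missed only if its distance from the heaviest
  candidate of the guess is a multiple of the gcd of \<open>I\<close> that is not a nonnegative combination of \<open>I\<close>
  (\<open>card_missed_le_card_gaps\<close>). After division by the gcd these are positive integers not representable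
  by the active tuple, and there are at most as many as its Frobenius number
  (\<open>card_gaps_le_frobenius\<close>). Summing over all types gives the bound \<^const>\<open>r_value\<close>
  (\<open>card_missed_le_r_value\<close>).

  For a divisor chain the smallest active value divides the others, so all Frobenius numbers in the sum
  are 0. For a pair of weights only the type in which both values are active contributes. So both
  special cases are instances of the general bound.

  The program is a nest of loops over the cells that hold the guess, and
  its correctness is shown with timed total-correctness rules for each instruction
  (\<open>reaches_test_guess\<close>, \<open>reaches_nested_loops\<close>).
\<close>

section \<open>Bounded representations\<close>

text \<open>Pigeonhole: two of the \<open>b + 1\<close> prefix sums of the first \<open>b\<close> entries agree modulo \<open>b\<close>.\<close>

lemma sublist_sum_divisible:
  fixes xs :: "nat list"
  assumes "b > 0" "b \<le> length xs"
  shows "\<exists>us ys vs. xs = us @ ys @ vs \<and> ys \<noteq> [] \<and> length ys \<le> b \<and> b dvd sum_list ys"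
proof -
  define s where "s i = sum_list (take i xs) mod b" for i
  have "s ` {..b} \<subseteq> {..<b}" using assms(1) by (auto simp: s_def)
  hence "card (s ` {..b}) < card {..b}" using card_mono[of "{..<b}" "s ` {..b}"] by simp
  then obtain i j where ij: "i < j" "j \<le> b" "s i = s j"
    using pigeonhole[of s "{..b}"] unfolding inj_on_def by (metis atMost_iff linorder_neqE_nat)
  define ys where "ys = drop i (take j xs)"
  have len: "length ys = j - i" using ij assms unfolding ys_def by simp
  have tk: "take j xs = take i xs @ ys"
    unfolding ys_def using ij by (metis append_take_drop_id min.absorb1 less_imp_le take_take)
  have "sum_list (take i xs) mod b = (sum_list (take i xs) + sum_list ys) mod b"
    using ij(3) unfolding s_def tk by simp
  hence "b dvd sum_list ys"
    by (metis add_diff_cancel_left' mod_eq_dvd_iff_nat le_add1)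
  moreover have "xs = take i xs @ ys @ drop j xs" by (metis append_take_drop_id tk append.assoc)
  moreover have "ys \<noteq> []" using len ij by auto
  ultimately show ?thesis using len ij by (metis diff_le_self le_trans)
qed

text \<open>The form in which the pigeonhole argument is used: among \<open>b\<close> coins, with \<open>e x\<close> coins of value
  \<open>x\<close>, some nonempty subfamily has a total that \<open>b\<close> divides, so it can be exchanged for coins of
  value \<open>b\<close>.\<close>

lemma subfamily_sum_divisible:
  fixes e :: "nat \<Rightarrow> nat"
  assumes fin: "finite A" and b: "b > 0" "b \<le> (\<Sum>x\<in>A. e x)"
  obtains h where "\<And>x. x \<in> A \<Longrightarrow> h x \<le> e x" "(\<Sum>x\<in>A. h x) > 0" "(\<Sum>x\<in>A. h x) \<le> b"
    "b dvd (\<Sum>x\<in>A. h x * x)"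
proof -
  define M where "M = (\<Sum>x\<in>A. replicate_mset (e x) x)"
  have cM: "count M y = (if y \<in> A then e y else 0)" for y
  proof -
    have "count M y = (\<Sum>x\<in>A. if x = y then e x else 0)" unfolding M_def count_sum
      by (intro sum.cong) auto
    thus ?thesis using fin by simp
  qed
  obtain xs where xs: "mset xs = M" using ex_mset by blast
  have "length xs = (\<Sum>x\<in>A. e x)" using arg_cong[OF xs, of size] by (simp add: M_def)
  then obtain us ys vs where ys: "xs = us @ ys @ vs" "ys \<noteq> []" "length ys \<le> b" "b dvd sum_list ys"
    using sublist_sum_divisible[of b xs] b by auto
  have le: "count (mset ys) x \<le> count M x" for x unfolding xs[symmetric] ys(1) by simp
  have sub: "set ys \<subseteq> A" 
  proof
    fix y assume "y \<in> set ys"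
    hence "count (mset ys) y > 0" by simp
    with le[of y] show "y \<in> A" unfolding cM by (auto split: if_splits)
  qed
  have s: "sum_list (map f ys) = (\<Sum>x\<in>A. count (mset ys) x * f x)" for f :: "nat \<Rightarrow> nat"
    unfolding sum_list_map_eq_sum_count2[OF sub fin] by (simp add: count_mset)
  show thesis
  proof (rule that[of "count (mset ys)"])
    show "count (mset ys) x \<le> e x" if "x \<in> A" for x using le[of x] cM[of x] that by simp
    have "(\<Sum>x\<in>A. count (mset ys) x) = length ys" using s[of "\<lambda>_. 1"] by (simp add: sum_list_triv)
    thus "(\<Sum>x\<in>A. count (mset ys) x) > 0" "(\<Sum>x\<in>A. count (mset ys) x) \<le> b" using ys by auto
    show "b dvd (\<Sum>x\<in>A. count (mset ys) x * x)" using s[of id] ys by simp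
  qed
qed

text \<open>Whenever there are at least \<open>b\<close> coins of values other than \<open>b\<close>, some of them can be exchanged for
  coins of value \<open>b\<close>.\<close>

lemma reduced_representation:
  fixes c :: "nat \<Rightarrow> nat"
  assumes fin: "finite A" and b: "b \<in> A" "b > 0"
  shows "\<exists>c'. (\<Sum>x\<in>A. c' x * x) = (\<Sum>x\<in>A. c x * x) \<and> (\<Sum>x\<in>A - {b}. c' x) < b"
proof (induction "\<Sum>x\<in>A - {b}. c x" arbitrary: c rule: less_induct)
  case less
  show ?case
  proof (cases "(\<Sum>x\<in>A - {b}. c x) < b")
    case False
    have finb: "finite (A - {b})" using fin by simp
    from False have "b \<le> (\<Sum>x\<in>A - {b}. c x)" by simp
    from subfamily_sum_divisible[OF finb b(2) this] obtain h where
      h: "\<And>x. x \<in> A - {b} \<Longrightarrow> h x \<le> c x" "(\<Sum>x\<in>A - {b}. h x) > 0"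
         "b dvd (\<Sum>x\<in>A - {b}. h x * x)" by blast
    from h(3) obtain t where t: "(\<Sum>x\<in>A - {b}. h x * x) = t * b" by (metis dvdE mult.commute)
    define c' where "c' x = (if x = b then c b + t else c x - h x)" for x
    have c'h: "(\<Sum>x\<in>A - {b}. c' x) + (\<Sum>x\<in>A - {b}. h x) = (\<Sum>x\<in>A - {b}. c x)"
      unfolding sum.distrib[symmetric] by (intro sum.cong) (auto simp: c'_def h(1))
    have "(\<Sum>x\<in>A - {b}. c' x * x) + t * b = (\<Sum>x\<in>A - {b}. c x * x)"
      unfolding t[symmetric] sum.distrib[symmetric]
      by (intro sum.cong) (auto simp: c'_def h(1) simp flip: add_mult_distrib)
    moreover have "(\<Sum>x\<in>A. c' x * x) = c' b * b + (\<Sum>x\<in>A - {b}. c' x * x)"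
      "(\<Sum>x\<in>A. c x * x) = c b * b + (\<Sum>x\<in>A - {b}. c x * x)"
      using fin b by (simp_all add: sum.remove)
    ultimately have "(\<Sum>x\<in>A. c' x * x) = (\<Sum>x\<in>A. c x * x)"
      by (simp add: c'_def algebra_simps)
    with less[of c'] c'h h(2) show ?thesis by auto
  qed blast
qed

text \<open>The exchange in the other direction. If too many coins of value \<open>b\<close> are used, some of them are
  traded for coins that are still free. The assumption on the room left below the full amount ensures
  that at least \<open>b\<close> coins other than \<open>b\<close> are free, so the pigeonhole argument supplies a trade; and
  as a trade involves at most \<open>b\<close> new coins, each worth at most \<open>m\<close>, it takes at most
  \<open>m \<le> L b\<close> coins of value \<open>b\<close> away, which are present.\<close>

lemma fill_representation:
  fixes c L :: "nat \<Rightarrow> nat"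
  assumes fin: "finite A" and A: "\<And>x. x \<in> A \<Longrightarrow> 0 < x \<and> x \<le> m \<and> m \<le> L x" and b: "b \<in> A"
    and c: "\<And>x. x \<in> A - {b} \<Longrightarrow> c x \<le> L x"
    and room: "(\<Sum>x\<in>A. c x * x) + m * b \<le> (\<Sum>x\<in>A. L x * x)"
  shows "\<exists>e. (\<forall>x\<in>A. e x \<le> L x) \<and> (\<Sum>x\<in>A. e x * x) = (\<Sum>x\<in>A. c x * x)"
  using c room
proof (induction "c b" arbitrary: c rule: less_induct)
  case less
  show ?case
  proof (cases "c b \<le> L b")
    case True
    with less.prems show ?thesis by (intro exI[of _ c]) auto
  next
    case False
    have finb: "finite (A - {b})" using fin by simp
    have b0: "b > 0" using A b by blast
    have split: "(\<Sum>x\<in>A. g x * x) = g b * b + (\<Sum>x\<in>A - {b}. g x * x)" for g :: "nat \<Rightarrow> nat"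
      using fin b by (simp add: sum.remove)
    define e where "e x = L x - c x" for x
    have eL: "(\<Sum>x\<in>A - {b}. e x * x) + (\<Sum>x\<in>A - {b}. c x * x) = (\<Sum>x\<in>A - {b}. L x * x)"
      unfolding sum.distrib[symmetric]
      by (intro sum.cong) (auto simp: e_def less.prems(1) simp flip: add_mult_distrib)
    have "b \<le> (\<Sum>x\<in>A - {b}. e x)"
    proof (rule ccontr)
      assume small: "\<not> ?thesis"
      have "(\<Sum>x\<in>A - {b}. e x * x) \<le> (\<Sum>x\<in>A - {b}. e x * m)"
        using A by (intro sum_mono mult_left_mono) auto
      also have "\<dots> = (\<Sum>x\<in>A - {b}. e x) * m" by (simp add: sum_distrib_right)
      also have "\<dots> \<le> b * m" using small by (intro mult_right_mono) auto
      finally have "(\<Sum>x\<in>A - {b}. e x * x) \<le> m * b" by (simp add: mult.commute)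
      moreover have "L b * b < c b * b" using False b0 by simp
      ultimately show False using less.prems(2) split[of L] split[of c] eL by linarith
    qed
    from subfamily_sum_divisible[OF finb b0 this] obtain h where
      h: "\<And>x. x \<in> A - {b} \<Longrightarrow> h x \<le> e x" "(\<Sum>x\<in>A - {b}. h x) > 0"
         "(\<Sum>x\<in>A - {b}. h x) \<le> b" "b dvd (\<Sum>x\<in>A - {b}. h x * x)" by blast
    from h(4) obtain t where t: "(\<Sum>x\<in>A - {b}. h x * x) = t * b" by (metis dvdE mult.commute)
    have "(\<Sum>x\<in>A - {b}. h x * x) \<le> (\<Sum>x\<in>A - {b}. h x * m)"
      using A by (intro sum_mono mult_left_mono) auto
    also have "\<dots> = (\<Sum>x\<in>A - {b}. h x) * m" by (simp add: sum_distrib_right)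
    also have "\<dots> \<le> b * m" using h(3) by (intro mult_right_mono) auto
    finally have "t \<le> m" using b0 unfolding t by (simp add: mult.commute)
    hence tc: "t \<le> c b" using False A[OF b] by linarith
    have "(\<Sum>x\<in>A - {b}. h x) \<le> (\<Sum>x\<in>A - {b}. h x * x)"
      using A by (intro sum_mono) (simp add: Suc_le_eq)
    hence t0: "t > 0" using h(2) t b0 by (cases t) auto
    define c' where "c' x = (if x = b then c b - t else c x + h x)" for x
    have "(\<Sum>x\<in>A - {b}. c' x * x) = (\<Sum>x\<in>A - {b}. c x * x) + t * b"
      unfolding t[symmetric] sum.distrib[symmetric]
      by (intro sum.cong) (auto simp: c'_def add_mult_distrib)
    moreover have "c' b * b + t * b = c b * b"
      using tc by (simp add: c'_def flip: add_mult_distrib)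
    ultimately have eq: "(\<Sum>x\<in>A. c' x * x) = (\<Sum>x\<in>A. c x * x)"
      using split[of c] split[of c'] by linarith
    have "\<exists>e. (\<forall>x\<in>A. e x \<le> L x) \<and> (\<Sum>x\<in>A. e x * x) = (\<Sum>x\<in>A. c' x * x)"
    proof (rule less.hyps)
      show "c' b < c b" using t0 tc by (simp add: c'_def)
      show "c' x \<le> L x" if "x \<in> A - {b}" for x
        using h(1)[OF that] less.prems(1)[OF that] that by (auto simp: c'_def e_def)
      show "(\<Sum>x\<in>A. c' x * x) + m * b \<le> (\<Sum>x\<in>A. L x * x)" using less.prems(2) eq by simp
    qed
    thus ?thesis using eq by simp
  qed
qed

text \<open>The saturation property of a supply of at least \<open>m\<close> coins of each value: an amount is payable from
  the supply as soon as it and its complement are payable with unlimited coins. Reduce both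
  representations with respect to some value \<open>b\<close>, so that all other multiplicities are below
  \<open>b \<le> m\<close>. If the complement also uses at most \<open>L b\<close> coins of value \<open>b\<close>, its own complement pays
  the amount. Otherwise the complement exceeds \<open>m * b\<close>, which is the room that trading needs.\<close>

lemma bounded_representation:
  fixes c d L :: "nat \<Rightarrow> nat"
  assumes fin: "finite A" and A: "\<And>x. x \<in> A \<Longrightarrow> 0 < x \<and> x \<le> m \<and> m \<le> L x"
    and cd: "(\<Sum>x\<in>A. c x * x) + (\<Sum>x\<in>A. d x * x) = (\<Sum>x\<in>A. L x * x)"
  shows "\<exists>e. (\<forall>x\<in>A. e x \<le> L x) \<and> (\<Sum>x\<in>A. e x * x) = (\<Sum>x\<in>A. c x * x)"
proof (cases "A = {}")
  case False
  then obtain b where b: "b \<in> A" by blast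
  have b0: "b > 0" "b \<le> m" using A b by auto
  have small: "g x \<le> L x" if "(\<Sum>x\<in>A - {b}. g x) < b" "x \<in> A - {b}" for g x
  proof -
    have "g x \<le> (\<Sum>x\<in>A - {b}. g x)" using fin that(2) by (intro member_le_sum) auto
    thus ?thesis using that b0 A[of x] by simp
  qed
  obtain c' where c': "(\<Sum>x\<in>A. c' x * x) = (\<Sum>x\<in>A. c x * x)" "(\<Sum>x\<in>A - {b}. c' x) < b"
    using reduced_representation[OF fin b b0(1)] by blast
  obtain d' where d': "(\<Sum>x\<in>A. d' x * x) = (\<Sum>x\<in>A. d x * x)" "(\<Sum>x\<in>A - {b}. d' x) < b"
    using reduced_representation[OF fin b b0(1)] by blast
  show ?thesis
  proof (cases "d' b \<le> L b")
    case True
    hence dL: "d' x \<le> L x" if "x \<in> A" for x using small[OF d'(2)] that by blast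
    have "(\<Sum>x\<in>A. (L x - d' x) * x) + (\<Sum>x\<in>A. d' x * x) = (\<Sum>x\<in>A. L x * x)"
      unfolding sum.distrib[symmetric]
      by (intro sum.cong) (auto simp: dL simp flip: add_mult_distrib)
    hence "(\<Sum>x\<in>A. (L x - d' x) * x) = (\<Sum>x\<in>A. c x * x)" using cd d'(1) by linarith
    thus ?thesis by (intro exI[of _ "\<lambda>x. L x - d' x"]) simp
  next
    case False
    hence "m * b \<le> d' b * b" using A[OF b] by (intro mult_right_mono) auto
    also have "\<dots> \<le> (\<Sum>x\<in>A. d' x * x)" using fin b by (intro member_le_sum) auto
    finally have "(\<Sum>x\<in>A. c' x * x) + m * b \<le> (\<Sum>x\<in>A. L x * x)" using cd c'(1) d'(1) by linarith
    from fill_representation[OF fin A b small[OF c'(2)] this] show ?thesis using c'(1) by simp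
  qed
qed simp

section \<open>Gaps of the semigroup spanned by a set\<close>

lemma Gcd_eq_int_combination:
  assumes "finite (A :: nat set)"
  shows "\<exists>u. (\<Sum>x\<in>A. u x * int x) = int (Gcd A)"
  using assms
proof (induction A)
  case (insert y A)
  then obtain u where u: "(\<Sum>x\<in>A. u x * int x) = int (Gcd A)" by blast
  obtain p q where pq: "p * int y + q * int (Gcd A) = gcd (int y) (int (Gcd A))"
    using bezout_int by blast
  have "(\<Sum>x\<in>insert y A. (if x = y then p else q * u x) * int x) = p * int y + q * (\<Sum>x\<in>A. u x * int x)"
  proof -
    have "(\<Sum>x\<in>A. (if x = y then p else q * u x) * int x) = (\<Sum>x\<in>A. q * (u x * int x))"
      using insert.hyps by (intro sum.cong) auto
    thus ?thesis using insert.hyps by (simp add: sum_distrib_left)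
  qed
  also have "\<dots> = int (Gcd (insert y A))" unfolding u pq by simp
  finally show ?case by (rule exI[of _ "\<lambda>x. if x = y then p else q * u x"])
qed simp

text \<open>The variant of \<^const>\<open>representable\<close> with multiplicities indexed by values in place of
  positions.\<close>

definition combination :: "nat set \<Rightarrow> nat \<Rightarrow> bool" where
  "combination A k \<longleftrightarrow> (\<exists>c. k = (\<Sum>x\<in>A. c x * x))"

text \<open>Reduce the coefficients of an integer combination modulo \<open>b\<close>; this changes its value by a multiple
  of \<open>b\<close>, and a large \<open>k\<close> absorbs the difference as copies of \<open>b\<close>.\<close>

lemma combination_of_large:
  assumes fin: "finite A" and b: "b \<in> A" "b > 0" and k: "Gcd A dvd k" "b * (\<Sum>x\<in>A. x) \<le> k"
  shows "combination A k"
proof -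
  obtain t where t: "k = Gcd A * t" using k(1) by (elim dvdE)
  obtain u where u: "(\<Sum>x\<in>A. u x * int x) = int (Gcd A)" using Gcd_eq_int_combination[OF fin] by blast
  define c where "c x = nat ((int t * u x) mod int b)" for x
  have c: "int (c x) = (int t * u x) mod int b" for x using b by (simp add: c_def)
  have "(\<Sum>x\<in>A. c x * x) \<le> (\<Sum>x\<in>A. b * x)"
  proof (intro sum_mono mult_right_mono)
    show "c x \<le> b" for x using c[of x] b(2) pos_mod_bound[of "int b" "int t * u x"] by linarith
  qed simp
  hence le: "(\<Sum>x\<in>A. c x * x) \<le> k" using k(2) by (simp add: sum_distrib_left)
  have "int (\<Sum>x\<in>A. c x * x) mod int b = (\<Sum>x\<in>A. (int t * u x) mod int b * int x) mod int b"
    by (simp add: c)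
  also have "\<dots> = (\<Sum>x\<in>A. ((int t * u x) mod int b * int x) mod int b) mod int b"
    by (rule mod_sum_eq[symmetric])
  also have "\<dots> = (\<Sum>x\<in>A. (int t * u x * int x) mod int b) mod int b"
    by (simp only: mod_mult_left_eq)
  also have "\<dots> = (\<Sum>x\<in>A. int t * u x * int x) mod int b"
    by (rule mod_sum_eq)
  also have "(\<Sum>x\<in>A. int t * u x * int x) = int k"
    unfolding t using u by (simp add: sum_distrib_left[symmetric] mult.assoc)
  finally have "(\<Sum>x\<in>A. c x * x) mod b = k mod b" by (metis of_nat_eq_iff zmod_int)
  then obtain s where s: "k = (\<Sum>x\<in>A. c x * x) + b * s"
    using le by (metis mod_eq_nat1E)
  have "(\<Sum>x\<in>A. (c x + (if x = b then s else 0)) * x) = k"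
    unfolding s add_mult_distrib sum.distrib using fin b(1) by (simp add: if_distrib[of "\<lambda>y. y * _"] cong: if_cong)
  thus ?thesis unfolding combination_def by metis
qed


text \<open>The gaps of the semigroup spanned by \<open>A\<close> inside the group spanned by \<open>A\<close>. Keeping the values
  undivided avoids rescaling the weights; division by \<^term>\<open>Gcd A\<close> turns these gaps into those of a
  primitive tuple.\<close>

definition gaps :: "nat set \<Rightarrow> nat set" where
  "gaps A = {k. Gcd A dvd k \<and> \<not> combination A k}"

lemma gaps_empty [simp]: "gaps {} = {}"
  by (auto simp: gaps_def combination_def)

lemma finite_gaps:
  assumes "finite A" "\<And>x. x \<in> A \<Longrightarrow> x > 0"
  shows "finite (gaps A)"
proof (cases "A = {}")
  case False
  then obtain b where b: "b \<in> A" by blast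
  have "gaps A \<subseteq> {..b * (\<Sum>x\<in>A. x)}"
    using combination_of_large[OF assms(1) b assms(2)[OF b]] by (force simp: gaps_def)
  thus ?thesis by (rule finite_subset) simp
qed simp

lemma representable_map_iff:
  assumes "distinct ys"
  shows "representable (map h ys) k \<longleftrightarrow> (\<exists>c. k = (\<Sum>x\<in>set ys. c x * h x))"
proof -
  have bij: "bij_betw ((!) ys) {..<length ys} (set ys)" using bij_betw_nth[OF assms] by simp
  have *: "(\<Sum>i<length ys. c (ys ! i) * h (ys ! i)) = (\<Sum>x\<in>set ys. c x * h x)" for c :: "'a \<Rightarrow> nat"
    by (rule sum.reindex_bij_betw[OF bij, of "\<lambda>x. c x * h x"])
  show ?thesis
  proof
    assume "representable (map h ys) k"
    then obtain c where c: "k = (\<Sum>i<length ys. c i * h (ys ! i))" by (auto simp: representable_def)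
    define c' where "c' x = c (the_inv_into {..<length ys} ((!) ys) x)" for x
    have "c' (ys ! i) = c i" if "i < length ys" for i
      unfolding c'_def using bij that by (subst the_inv_into_f_f) (auto simp: bij_betw_def)
    hence "k = (\<Sum>x\<in>set ys. c' x * h x)" unfolding c *[symmetric] by simp
    thus "\<exists>c. k = (\<Sum>x\<in>set ys. c x * h x)" by blast
  next
    assume "\<exists>c. k = (\<Sum>x\<in>set ys. c x * h x)"
    then obtain c where "k = (\<Sum>x\<in>set ys. c x * h x)" by blast
    hence "k = (\<Sum>i<length (map h ys). c (ys ! i) * map h ys ! i)" by (simp add: *)
    thus "representable (map h ys) k" unfolding representable_def
      by (rule exI[of _ "\<lambda>i. c (ys ! i)"])
  qed
qed

text \<open>Division by the gcd turns the gaps into positive integers, of which there are at most as many as the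
  largest of them; if the divided tuple contains 1, there are none.\<close>

lemma card_gaps_le_frobenius:
  assumes dist: "distinct ys" and ne: "ys \<noteq> []" and pos: "\<And>x. x \<in> set ys \<Longrightarrow> x > 0"
  shows "card (gaps (set ys)) \<le> frobenius (map (\<lambda>x. x div Gcd (set ys)) ys)"
proof -
  define g where "g = Gcd (set ys)"
  define xs where "xs = map (\<lambda>x. x div g) ys"
  obtain b where b: "b \<in> set ys" using ne by (metis list.set_intros(1) neq_Nil_conv)
  have g: "g > 0" unfolding g_def using pos[OF b] b by (auto simp: Gcd_0_iff intro!: Nat.gr0I)
  have dvd: "g dvd x" if "x \<in> set ys" for x unfolding g_def using that by simp
  have rep: "representable xs k \<longleftrightarrow> combination (set ys) (g * k)" for k
  proof -
    have *: "g * (\<Sum>x\<in>set ys. c x * (x div g)) = (\<Sum>x\<in>set ys. c x * x)" for c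
      unfolding sum_distrib_left by (intro sum.cong) (auto simp: dvd mult.left_commute)
    show ?thesis unfolding xs_def representable_map_iff[OF dist] combination_def
      unfolding *[symmetric] using g by simp
  qed
  have eq: "gaps (set ys) = (*) g ` {k. \<not> representable xs k}"
    by (auto simp: gaps_def rep g_def[symmetric] elim!: dvdE)
  have "inj_on ((*) g) X" for X using g by (auto simp: inj_on_def)
  hence card: "card (gaps (set ys)) = card {k. \<not> representable xs k}" 
    and fin: "finite {k. \<not> representable xs k}"
    using finite_gaps[of "set ys"] pos unfolding eq by (auto simp: card_image dest: finite_imageD)
  have "card {k. \<not> representable xs k} \<le> frobenius xs"
  proof (cases "1 \<in> set xs")
    case True
    then obtain i where i: "i < length xs" "xs ! i = 1" by (auto simp: in_set_conv_nth)
    have "representable xs k" for k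
    proof -
      have "(\<Sum>j<length xs. (if j = i then k else 0) * xs ! j) = (\<Sum>j<length xs. if j = i then k else 0)"
        using i(2) by (intro sum.cong) auto
      also have "\<dots> = k" using i(1) by simp
      finally show ?thesis unfolding representable_def by metis
    qed
    thus ?thesis by simp
  next
    case False
    have "k \<in> {1..(GREATEST k. \<not> representable xs k)}" if "\<not> representable xs k" for k
    proof -
      have "representable xs 0" unfolding representable_def by (intro exI[of _ "\<lambda>_. 0"]) simp
      hence "k \<noteq> 0" using that by metis
      moreover obtain B where "\<forall>k\<in>{k. \<not> representable xs k}. k \<le> B"
        using fin finite_nat_set_iff_bounded_le by blast
      hence "k \<le> (GREATEST k. \<not> representable xs k)"
        using that by (intro Greatest_le_nat[where b = B]) auto
      ultimately show ?thesis by simp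
    qed
    hence "card {k. \<not> representable xs k} \<le> card {1..(GREATEST k. \<not> representable xs k)}"
      by (intro card_mono) auto
    thus ?thesis using False ne by (simp add: frobenius_def xs_def)
  qed
  thus ?thesis unfolding card xs_def g_def .
qed

section \<open>Active tuples\<close>

text \<open>Everything below is indexed by weight values, since the entries of a primitive tuple are distinct.\<close>

definition active_values :: "nat list \<Rightarrow> nat list \<Rightarrow> nat set" where
  "active_values a \<mu> = (!) a ` active_set (max_vector a) \<mu>"

lemma active_tuple_by_values:
  assumes "distinct a"
  obtains ys where "distinct ys" "set ys = active_values a \<mu>"
    "active_tuple a (max_vector a) \<mu> = map (\<lambda>x. x div Gcd (active_values a \<mu>)) ys"
proof
  let ?is = "filter (\<lambda>i. i \<in> active_set (max_vector a) \<mu>) [0..<length a]"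
  show "distinct (map ((!) a) ?is)"
    using assms by (auto simp: distinct_map inj_on_def nth_eq_iff_index_eq)
  show "set (map ((!) a) ?is) = active_values a \<mu>"
    by (auto simp: active_values_def active_set_def max_vector_def)
  show "active_tuple a (max_vector a) \<mu> =
      map (\<lambda>x. x div Gcd (active_values a \<mu>)) (map ((!) a) ?is)"
    by (simp add: active_tuple_def active_values_def)
qed

lemma active_values_subset: "active_values a \<mu> \<subseteq> set a"
  by (auto simp: active_values_def active_set_def max_vector_def)

lemma card_gaps_le_frobenius_active_tuple:
  assumes "distinct a" "\<forall>x\<in>set a. x > 0"
  shows "card (gaps (active_values a \<mu>)) \<le> frobenius (active_tuple a (max_vector a) \<mu>)"
proof (cases "active_values a \<mu> = {}")
  case False
  obtain ys where ys: "distinct ys" "set ys = active_values a \<mu>"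
    "active_tuple a (max_vector a) \<mu> = map (\<lambda>x. x div Gcd (active_values a \<mu>)) ys"
    using active_tuple_by_values[OF assms(1)] .
  show ?thesis unfolding ys(3) ys(2)[symmetric]
    using ys False assms(2) active_values_subset[of a \<mu>] by (intro card_gaps_le_frobenius) auto
qed simp

text \<open>If a least active value divides all others, it is their gcd and yields the entry 1. This covers
  divisor chains and single active values.\<close>

lemma frobenius_active_tuple_eq_0:
  assumes "distinct a" "\<forall>x\<in>set a. x > 0"
    and least: "active_values a \<mu> \<noteq> {} \<Longrightarrow> \<exists>b\<in>active_values a \<mu>. \<forall>x\<in>active_values a \<mu>. b dvd x"
  shows "frobenius (active_tuple a (max_vector a) \<mu>) = 0"
proof (cases "active_values a \<mu> = {}")
  case False
  obtain ys where ys: "set ys = active_values a \<mu>"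
    "active_tuple a (max_vector a) \<mu> = map (\<lambda>x. x div Gcd (active_values a \<mu>)) ys"
    using active_tuple_by_values[OF assms(1)] .
  obtain b where b: "b \<in> active_values a \<mu>" "\<forall>x\<in>active_values a \<mu>. b dvd x" using least False by blast
  have "Gcd (active_values a \<mu>) = b" using b by (intro dvd_antisym) (auto intro: Gcd_greatest)
  moreover have "b > 0" using b(1) active_values_subset assms(2) by blast
  hence "b div Gcd (active_values a \<mu>) = 1"
    using \<open>Gcd (active_values a \<mu>) = b\<close> by simp
  hence "1 \<in> set (active_tuple a (max_vector a) \<mu>)"
    unfolding ys(2) using ys(1) b(1) by (force simp: image_iff)
  thus ?thesis by (simp add: frobenius_def)
next
  case True
  obtain ys where "set ys = active_values a \<mu>"
    "active_tuple a (max_vector a) \<mu> = map (\<lambda>x. x div Gcd (active_values a \<mu>)) ys"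
    using active_tuple_by_values[OF assms(1)] .
  thus ?thesis using True by (simp add: frobenius_def)
qed

lemma finite_below_max_vector: "finite {\<mu>. list_all2 (\<le>) \<mu> (max_vector a)}"
proof (rule finite_subset)
  show "{\<mu>. list_all2 (\<le>) \<mu> (max_vector a)} \<subseteq> {\<mu>. set \<mu> \<subseteq> {..Max (set a)} \<and> length \<mu> = length a}"
    by (auto simp: list_all2_conv_all_nth max_vector_def in_set_conv_nth)
  show "finite {\<mu>. set \<mu> \<subseteq> {..Max (set a)} \<and> length \<mu> = length a}"
    by (rule finite_lists_length_eq) simp
qed

lemma r_value_divisor_chain:
  assumes "primitive_tuple a" and chain: "\<forall>i. Suc i < length a \<longrightarrow> a ! i dvd a ! Suc i"
  shows "r_value a = 0"
proof -
  have dvd: "a ! i dvd a ! j" if "i \<le> j" "j < length a" for i j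
    using that
  proof (induction j rule: dec_induct)
    case (step j)
    thus ?case using chain by (metis Suc_lessD dvd_trans)
  qed simp
  have "frobenius (active_tuple a (max_vector a) \<mu>) = 0" for \<mu>
  proof (rule frobenius_active_tuple_eq_0)
    assume "active_values a \<mu> \<noteq> {}"
    hence ne: "active_set (max_vector a) \<mu> \<noteq> {}" by (auto simp: active_values_def)
    define i where "i = (LEAST i. i \<in> active_set (max_vector a) \<mu>)"
    have "i \<in> active_set (max_vector a) \<mu>" unfolding i_def using ne by (metis LeastI ex_in_conv)
    moreover have "a ! i dvd a ! j" if "j \<in> active_set (max_vector a) \<mu>" for j
      using that dvd[of i j] Least_le[of "\<lambda>i. i \<in> active_set (max_vector a) \<mu>" j]
      by (auto simp: i_def active_set_def max_vector_def)
    ultimately show "\<exists>b\<in>active_values a \<mu>. \<forall>x\<in>active_values a \<mu>. b dvd x"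
      by (auto simp: active_values_def)
  qed (use assms(1) in \<open>auto simp: primitive_tuple_def\<close>)
  thus ?thesis by (simp add: r_value_def)
qed

lemma r_value_pair:
  assumes "primitive_tuple a" "length a = 2"
  shows "r_value a = frobenius a"
proof -
  have a: "distinct a" "\<forall>x\<in>set a. x > 0" "Gcd (set a) = 1"
    using assms(1) by (auto simp: primitive_tuple_def)
  let ?top = "max_vector a"
  have zero: "frobenius (active_tuple a (max_vector a) \<mu>) = 0" 
    if \<mu>: "list_all2 (\<le>) \<mu> ?top" "\<mu> \<noteq> ?top" for \<mu>
  proof (rule frobenius_active_tuple_eq_0[OF a(1,2)])
    assume ne: "active_values a \<mu> \<noteq> {}"
    from \<mu> obtain i where i: "i < 2" "\<mu> ! i \<noteq> ?top ! i"
      using assms(2) by (auto simp: list_eq_iff_nth_eq list_all2_lengthD max_vector_def)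
    hence "active_set ?top \<mu> \<subseteq> {1 - i}" using assms(2) 
      by (auto simp: active_set_def max_vector_def less_2_cases_iff)
    hence "active_values a \<mu> \<subseteq> {a ! (1 - i)}" by (auto simp: active_values_def)
    hence "active_values a \<mu> = {a ! (1 - i)}" using ne by blast
    thus "\<exists>b\<in>active_values a \<mu>. \<forall>x\<in>active_values a \<mu>. b dvd x" by simp
  qed
  have I: "active_set ?top ?top = {..<length a}" by (auto simp: active_set_def max_vector_def)
  have "(!) a ` {..<length a} = set a" by (auto simp: set_conv_nth)
  hence "active_tuple a ?top ?top = map ((!) a) [0..<length a]"
    using a(3) by (simp add: active_tuple_def I)
  hence top: "active_tuple a ?top ?top = a" by (simp add: map_nth)
  have "r_value a = (\<Sum>\<mu> | list_all2 (\<le>) \<mu> ?top. if \<mu> = ?top then frobenius a else 0)"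
    unfolding r_value_def by (intro sum.cong) (auto simp: zero top)
  also have "\<dots> = frobenius a"
    using finite_below_max_vector[of a] by (simp add: list_all2_refl)
  finally show ?thesis .
qed

section \<open>Guessing part of a feasible set\<close>

lemma initial_segment_of_card:
  fixes Y :: "nat set"
  assumes "e \<le> card {j \<in> Y. j < n}"
  shows "\<exists>k\<le>n. card {j \<in> Y. j < k} = e"
  using assms
proof (induction n)
  case (Suc n)
  show ?case
  proof (cases "e \<le> card {j \<in> Y. j < n}")
    case True
    thus ?thesis using Suc.IH le_SucI by blast
  next
    case False
    have "{j \<in> Y. j < Suc n} \<subseteq> insert n {j \<in> Y. j < n}" by auto
    hence "card {j \<in> Y. j < Suc n} \<le> card (insert n {j \<in> Y. j < n})" by (intro card_mono) auto
    hence "card {j \<in> Y. j < Suc n} \<le> Suc (card {j \<in> Y. j < n})" by simp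
    hence "card {j \<in> Y. j < Suc n} = e" using False Suc.prems by linarith
    thus ?thesis by blast
  qed
qed simp

text \<open>The combinatorial content of the optimization problem: feasible sets are subsets of
  \<open>{..<n}\<close>, and \<open>Y T I\<close> is a feasible set that first of all contains as much of \<open>T\<close> as possible and
  then maximizes the weight outside \<open>T\<close> that is carried by values in \<open>I\<close>. The bonus \<open>B\<close> exceeds every sum of
  weights, so including \<open>T\<close> takes priority.\<close>

locale weighted_family =
  fixes n m B :: nat and A :: "nat set" and W :: "nat \<Rightarrow> nat" and F :: "nat set set"
    and Y :: "nat set \<Rightarrow> nat set \<Rightarrow> nat set"
  assumes finite_A: "finite A" and A: "x \<in> A \<Longrightarrow> 0 < x \<and> x \<le> m"
    and W: "j < n \<Longrightarrow> W j \<in> A"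
    and F: "X \<in> F \<Longrightarrow> X \<subseteq> {..<n}"
    and B: "n * m < B"
    and Y: "T \<subseteq> {..<n} \<Longrightarrow> I \<subseteq> A \<Longrightarrow> Y T I \<in> F"
    and Y_max: "T \<subseteq> {..<n} \<Longrightarrow> I \<subseteq> A \<Longrightarrow> X \<in> F \<Longrightarrow>
      (\<Sum>j\<in>X. if j \<in> T then B else if W j \<in> I then W j else 0)
      \<le> (\<Sum>j\<in>Y T I. if j \<in> T then B else if W j \<in> I then W j else 0)"
begin

definition weight :: "nat set \<Rightarrow> nat" where
  "weight X = (\<Sum>j\<in>X. W j)"

definition occ :: "nat set \<Rightarrow> nat \<Rightarrow> nat" where
  "occ X x = card {j \<in> X. W j = x}"

text \<open>Only elements of \<open>Y T I\<close> that were guessed or carry a value in \<open>I\<close> are kept; the thresholds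
  \<open>\<nu>\<close> then thin them out. Letting a threshold vary over \<open>{..n}\<close> realizes every smaller number of
  elements of its value.\<close>

definition select :: "nat set \<Rightarrow> nat set \<Rightarrow> (nat \<Rightarrow> nat) \<Rightarrow> nat set" where
  "select T I \<nu> = {j \<in> Y T I. (W j \<in> I \<or> j \<in> T) \<and> j < \<nu> (W j)}"

text \<open>The condition \<open>n > 0\<close> allows \<open>I\<close> to be guessed by flags that range over \<open>{..n}\<close>; for \<open>n = 0\<close>
  such flags can only describe the empty set.\<close>

definition found :: "nat set" where
  "found = {weight (select T I \<nu>) | T I \<nu>. T \<subseteq> {..<n} \<and> card T \<le> card A * m \<and> I \<subseteq> A \<and>
     (I \<noteq> {} \<longrightarrow> n > 0) \<and> (\<forall>x. \<nu> x \<le> n)}"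

lemma sum_weights_by_value:
  assumes "X \<subseteq> {..<n}" "I \<subseteq> A"
  shows "(\<Sum>j | j \<in> X \<and> W j \<in> I. W j) = (\<Sum>x\<in>I. occ X x * x)"
proof -
  have fin: "finite X" "finite I" using assms finite_A finite_subset by auto
  have "(\<Sum>x\<in>I. occ X x * x) = (\<Sum>x\<in>I. \<Sum>j | j \<in> {j. j \<in> X \<and> W j \<in> I} \<and> W j = x. W j)"
  proof (rule sum.cong)
    fix x assume "x \<in> I"
    hence "{j. j \<in> {j. j \<in> X \<and> W j \<in> I} \<and> W j = x} = {j \<in> X. W j = x}" by auto
    thus "occ X x * x = (\<Sum>j | j \<in> {j. j \<in> X \<and> W j \<in> I} \<and> W j = x. W j)"
      by (simp add: occ_def)
  qed simp
  also have "\<dots> = (\<Sum>j | j \<in> X \<and> W j \<in> I. W j)" using fin by (intro sum.group) auto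
  finally show ?thesis ..
qed

lemma weight_by_value:
  assumes "X \<subseteq> {..<n}"
  shows "weight X = (\<Sum>x\<in>A. occ X x * x)"
proof -
  have "{j. j \<in> X \<and> W j \<in> A} = X" using assms W by auto
  thus ?thesis using sum_weights_by_value[OF assms, of A] by (simp add: weight_def)
qed

text \<open>Fix how many elements of each value a feasible set has, counting only up to \<open>m\<close>, and let \<open>I\<close> be
  the values for which the count reaches \<open>m\<close>. Let \<open>T\<close> consist of that many elements of a heaviest
  feasible set \<open>X0\<close> of this type. Then \<open>Y T I\<close> contains \<open>T\<close> and is at least as heavy on \<open>I\<close> as
  \<open>X0\<close>. Hence every weight \<open>v\<close> of the type is at most the largest selected weight \<open>t\<close>, both being
  congruent modulo the gcd of \<open>I\<close>. By saturation, \<open>v\<close> is selected unless \<open>t - v\<close> is a gap.\<close>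

lemma card_missed_le_card_gaps:
  fixes \<tau> :: "nat \<Rightarrow> nat"
  defines "I \<equiv> {x \<in> A. \<tau> x = m}"
  defines "X\<^sub>\<tau> \<equiv> {X \<in> F. \<forall>x\<in>A. min m (occ X x) = \<tau> x}"
  shows "card (weight ` X\<^sub>\<tau> - found) \<le> card (gaps I)"
proof (cases "X\<^sub>\<tau> = {}")
  case False
  have F_sub: "F \<subseteq> Pow {..<n}" using F by auto
  hence "finite F" by (rule finite_subset) simp
  hence fin: "finite X\<^sub>\<tau>" unfolding X\<^sub>\<tau>_def by simp
  have "Max (weight ` X\<^sub>\<tau>) \<in> weight ` X\<^sub>\<tau>" using fin False by (intro Max_in) auto
  then obtain X0 where X0: "X0 \<in> X\<^sub>\<tau>" and "Max (weight ` X\<^sub>\<tau>) = weight X0" by blast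
  hence X0_max: "weight X \<le> weight X0" if "X \<in> X\<^sub>\<tau>" for X
    using fin that by (metis Max_ge finite_imageI imageI)
  have X0F: "X0 \<in> F" "X0 \<subseteq> {..<n}" using X0 F by (auto simp: X\<^sub>\<tau>_def)
  have finX0: "finite X0" using X0F finite_subset by blast
  have IA: "I \<subseteq> A" by (auto simp: I_def)
  hence finI: "finite I" using finite_A finite_subset by blast
  have \<tau>: "\<tau> x \<le> m" "\<tau> x \<le> occ X0 x" if "x \<in> A" for x
  proof -
    have "\<tau> x = min m (occ X0 x)" using X0 that by (simp add: X\<^sub>\<tau>_def)
    thus "\<tau> x \<le> m" "\<tau> x \<le> occ X0 x" by simp_all
  qed
  have "\<exists>T\<subseteq>{j \<in> X0. W j = x}. card T = \<tau> x" if "x \<in> A" for x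
  proof -
    have "\<tau> x \<le> card {j \<in> X0. W j = x}" using \<tau>(2)[OF that] by (simp add: occ_def)
    then obtain T where "T \<subseteq> {j \<in> X0. W j = x}" "card T = \<tau> x" by (rule obtain_subset_with_card_n)
    thus ?thesis by (intro exI[of _ T]) simp
  qed
  hence "\<exists>G. \<forall>x\<in>A. G x \<subseteq> {j \<in> X0. W j = x} \<and> card (G x) = \<tau> x" by (intro bchoice) blast
  then obtain G where G: "\<And>x. x \<in> A \<Longrightarrow> G x \<subseteq> {j \<in> X0. W j = x} \<and> card (G x) = \<tau> x" by blast
  define T where "T = (\<Union>x\<in>A. G x)"
  have TX0: "T \<subseteq> X0" using G by (auto simp: T_def)
  hence Tn: "T \<subseteq> {..<n}" and finT: "finite T" using X0F finX0 finite_subset by auto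
  have TG: "{j \<in> T. W j = x} = G x" if "x \<in> A" for x
    using G that by (fastforce simp: T_def)
  have "card T \<le> (\<Sum>x\<in>A. card (G x))" unfolding T_def by (rule card_UN_le[OF finite_A])
  also have "\<dots> \<le> (\<Sum>x\<in>A. m)" using G \<tau> by (intro sum_mono) auto
  finally have cardT: "card T \<le> card A * m" by simp
  define y where "y = Y T I"
  have yF: "y \<in> F" and yn: "y \<subseteq> {..<n}" using Y[OF Tn IA] F by (auto simp: y_def)
  have finy: "finite y" using yn finite_subset by blast
  \<comment> \<open>The objective of which \<open>y\<close> is a maximizer.\<close>
  define val where "val j = (if j \<in> T then B else if W j \<in> I then W j else 0)" for j
  have val_sum: "(\<Sum>j\<in>X. val j) = B * card (X \<inter> T) + (\<Sum>j\<in>X - T. if W j \<in> I then W j else 0)"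
    if "finite X" for X
  proof -
    have "(\<Sum>j\<in>X. val j) = (\<Sum>j\<in>X \<inter> T. val j) + (\<Sum>j\<in>X - T. val j)"
      using that by (metis sum.Int_Diff)
    also have "(\<Sum>j\<in>X \<inter> T. val j) = B * card (X \<inter> T)" by (simp add: val_def mult.commute)
    also have "(\<Sum>j\<in>X - T. val j) = (\<Sum>j\<in>X - T. if W j \<in> I then W j else 0)"
      by (intro sum.cong) (auto simp: val_def)
    finally show ?thesis .
  qed
  have le: "(\<Sum>j\<in>X0. val j) \<le> (\<Sum>j\<in>y. val j)"
    using Y_max[OF Tn IA X0F(1)] by (simp add: val_def y_def)
  have X0T: "X0 \<inter> T = T" using TX0 by blast
  have Ty: "T \<subseteq> y"
  proof (rule ccontr)
    assume "\<not> T \<subseteq> y"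
    hence "card (y \<inter> T) < card T" using finT by (intro psubset_card_mono) auto
    hence "B * card (y \<inter> T) + B \<le> B * card T" 
      by (metis Suc_leI mult_Suc_right add.commute mult_le_mono2)
    moreover have "(\<Sum>j\<in>y - T. if W j \<in> I then W j else 0) \<le> (\<Sum>j\<in>y - T. m)"
      using yn W A by (intro sum_mono) auto
    moreover have "(\<Sum>j\<in>y - T. m) \<le> n * m"
      using card_mono[of "{..<n}" "y - T"] yn by auto
    ultimately show False
      using le B unfolding val_sum[OF finy] val_sum[OF finX0] X0T by linarith
  qed
  hence yT: "y \<inter> T = T" by blast
  define L where "L = occ y"
  have part: "(\<Sum>x\<in>I. occ X x * x) = (\<Sum>j\<in>X - T. if W j \<in> I then W j else 0)
      + (\<Sum>j\<in>T. if W j \<in> I then W j else 0)" if "X \<subseteq> {..<n}" "T \<subseteq> X" for X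
  proof -
    have finX: "finite X" using that finite_subset by blast
    have "(\<Sum>x\<in>I. occ X x * x) = (\<Sum>j\<in>X. if W j \<in> I then W j else 0)"
      unfolding sum_weights_by_value[OF that(1) IA, symmetric] using finX
      by (subst sum.inter_filter) auto
    also have "\<dots> = (\<Sum>j\<in>X - T. if W j \<in> I then W j else 0) + (\<Sum>j\<in>T. if W j \<in> I then W j else 0)"
      using finX that(2) by (rule sum.subset_diff[rotated])
    finally show ?thesis .
  qed
  have top: "(\<Sum>x\<in>I. occ X0 x * x) \<le> (\<Sum>x\<in>I. L x * x)"
    using le unfolding val_sum[OF finy] val_sum[OF finX0] X0T yT
    unfolding L_def part[OF X0F(2) TX0] part[OF yn Ty] by simp
  have Lm: "m \<le> L x" if "x \<in> I" for x
  proof -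
    have x: "x \<in> A" "\<tau> x = m" using that by (auto simp: I_def)
    have "card (G x) \<le> card {j \<in> y. W j = x}" using TG[OF x(1)] Ty finy by (intro card_mono) auto
    thus ?thesis using G[OF x(1)] x(2) by (simp add: L_def occ_def)
  qed
  define base where "base = (\<Sum>x\<in>A - I. \<tau> x * x)"
  have split: "(\<Sum>x\<in>A. g x * x) = base + (\<Sum>x\<in>I. g x * x)"
    if "\<And>x. x \<in> A - I \<Longrightarrow> g x = \<tau> x" for g
    using sum.subset_diff[OF IA finite_A, of "\<lambda>x. g x * x"] that by (simp add: base_def)
  have found: "base + (\<Sum>x\<in>I. e x * x) \<in> found" if e: "\<And>x. x \<in> I \<Longrightarrow> e x \<le> L x" for e
  proof -
    have "\<exists>k\<le>n. card {j \<in> {j \<in> y. W j = x}. j < k} = e x" if "x \<in> I" for x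
    proof (rule initial_segment_of_card)
      have "{j \<in> {j \<in> y. W j = x}. j < n} = {j \<in> y. W j = x}" using yn by auto
      thus "e x \<le> card {j \<in> {j \<in> y. W j = x}. j < n}" using e[OF that] by (simp add: L_def occ_def)
    qed
    hence "\<exists>\<nu>'. \<forall>x\<in>I. \<nu>' x \<le> n \<and> card {j \<in> {j \<in> y. W j = x}. j < \<nu>' x} = e x" by (intro bchoice) blast
    then obtain \<nu>' where \<nu>': "\<And>x. x \<in> I \<Longrightarrow> \<nu>' x \<le> n \<and> card {j \<in> {j \<in> y. W j = x}. j < \<nu>' x} = e x"
      by blast
    \<comment> \<open>Thinning out applies to \<open>I\<close> only; for the other values \<open>y\<close> was already cut down to \<open>T\<close>.\<close>
    define \<nu> where "\<nu> x = (if x \<in> I then \<nu>' x else n)" for x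
    let ?Z = "select T I \<nu>"
    have Zn: "?Z \<subseteq> {..<n}" using yn by (auto simp: select_def y_def)
    have "occ ?Z x = e x" if "x \<in> I" for x
    proof -
      have "{j \<in> ?Z. W j = x} = {j \<in> {j \<in> y. W j = x}. j < \<nu>' x}"
        using that by (auto simp: select_def y_def \<nu>_def)
      thus ?thesis using \<nu>'[OF that] by (simp add: occ_def)
    qed
    moreover have "occ ?Z x = \<tau> x" if "x \<in> A - I" for x
    proof -
      have "{j \<in> ?Z. W j = x} = {j \<in> T. W j = x}"
        using that Ty Tn by (auto simp: select_def y_def \<nu>_def)
      thus ?thesis using G[of x] TG[of x] that by (simp add: occ_def)
    qed
    ultimately have "weight ?Z = base + (\<Sum>x\<in>I. e x * x)"
      unfolding weight_by_value[OF Zn] by (subst split) auto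
    moreover have "n > 0" if ne: "I \<noteq> {}"
    proof -
      obtain x where x: "x \<in> A" "\<tau> x = m" using ne by (auto simp: I_def)
      hence "G x \<noteq> {}" using G[of x] A[of x] by auto
      thus ?thesis using G[OF x(1)] X0F(2) by auto
    qed
    moreover have "\<forall>x. \<nu> x \<le> n" using \<nu>' by (auto simp: \<nu>_def)
    ultimately show ?thesis unfolding found_def using Tn cardT IA
      by (intro CollectI exI[of _ T] exI[of _ I] exI[of _ \<nu>]) auto
  qed
  define t where "t = base + (\<Sum>x\<in>I. L x * x)"
  have weight_X: "weight X = base + (\<Sum>x\<in>I. occ X x * x)" if "X \<in> X\<^sub>\<tau>" for X
  proof -
    have "X \<subseteq> {..<n}" using that F by (auto simp: X\<^sub>\<tau>_def)
    moreover have "occ X x = \<tau> x" if "x \<in> A - I" for x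
    proof -
      have "min m (occ X x) = \<tau> x" "\<tau> x \<noteq> m" 
        using \<open>X \<in> X\<^sub>\<tau>\<close> that by (auto simp: X\<^sub>\<tau>_def I_def)
      thus ?thesis by (auto simp: min_def split: if_splits)
    qed
    ultimately show ?thesis using split[of "occ X"] by (simp add: weight_by_value)
  qed
  have le_t: "weight X \<le> t" if "X \<in> X\<^sub>\<tau>" for X
    using X0_max[OF that] weight_X[OF X0] top by (simp add: t_def)
  have "(\<lambda>v. t - v) ` (weight ` X\<^sub>\<tau> - found) \<subseteq> gaps I"
  proof safe
    fix X assume X: "X \<in> X\<^sub>\<tau>" "weight X \<notin> found"
    have diff: "t - weight X = (\<Sum>x\<in>I. L x * x) - (\<Sum>x\<in>I. occ X x * x)"
      using weight_X[OF X(1)] by (simp add: t_def)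
    have "Gcd I dvd (\<Sum>x\<in>I. g x * x)" for g :: "nat \<Rightarrow> nat"
      by (intro dvd_sum dvd_mult) simp
    hence "Gcd I dvd t - weight X" unfolding diff by (intro dvd_diff_nat)
    moreover have "\<not> combination I (t - weight X)"
    proof
      assume "combination I (t - weight X)"
      then obtain d where "t - weight X = (\<Sum>x\<in>I. d x * x)" by (auto simp: combination_def)
      hence sum: "(\<Sum>x\<in>I. occ X x * x) + (\<Sum>x\<in>I. d x * x) = (\<Sum>x\<in>I. L x * x)"
        using le_t[OF X(1)] weight_X[OF X(1)] by (simp add: t_def)
      have "0 < x \<and> x \<le> m \<and> m \<le> L x" if "x \<in> I" for x using A Lm IA that by blast
      from bounded_representation[OF finI this sum] obtain e where
        "\<forall>x\<in>I. e x \<le> L x" "(\<Sum>x\<in>I. e x * x) = (\<Sum>x\<in>I. occ X x * x)" by blast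
      thus False using found[of e] X weight_X[OF X(1)] by simp
    qed
    ultimately show "t - weight X \<in> gaps I" by (simp add: gaps_def)
  qed
  moreover have "inj_on (\<lambda>v. t - v) (weight ` X\<^sub>\<tau> - found)"
  proof (rule inj_onI)
    fix v v' assume "v \<in> weight ` X\<^sub>\<tau> - found" "v' \<in> weight ` X\<^sub>\<tau> - found" "t - v = t - v'"
    moreover from this have "v \<le> t" "v' \<le> t" using le_t by auto
    ultimately show "v = v'" by linarith
  qed
  moreover have "finite (gaps I)" using finite_gaps[OF finI] A IA by blast
  ultimately show ?thesis by (metis card_inj_on_le)
qed simp

text \<open>The types of feasible sets are vectors \<open>\<mu>\<close> below the maximum vector, so the bounds for the single
  types add up to \<^const>\<open>r_value\<close>.\<close>

lemma card_missed_le_r_value: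
  assumes a: "distinct a" "set a = A" "A \<noteq> {}" and m: "m = Max A"
  shows "card (weight ` F - found) \<le> r_value a"
proof -
  define type where "type X = map (\<lambda>x. min m (occ X x)) a" for X
  define M where "M = {\<mu>. list_all2 (\<le>) \<mu> (max_vector a)}"
  have finM: "finite M" unfolding M_def by (rule finite_below_max_vector)
  have type: "type X \<in> M" for X
    by (auto simp: type_def M_def list_all2_conv_all_nth max_vector_def a(2) m)
  have "weight ` F - found \<subseteq> (\<Union>\<mu>\<in>M. weight ` {X \<in> F. type X = \<mu>} - found)"
    using type by auto
  moreover have "finite F" using F by (intro finite_subset[of F "Pow {..<n}"]) auto
  hence "finite (\<Union>\<mu>\<in>M. weight ` {X \<in> F. type X = \<mu>} - found)" using finM by simp
  ultimately have "card (weight ` F - found) \<le> card (\<Union>\<mu>\<in>M. weight ` {X \<in> F. type X = \<mu>} - found)"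
    by (rule card_mono[rotated])
  also have "\<dots> \<le> (\<Sum>\<mu>\<in>M. card (weight ` {X \<in> F. type X = \<mu>} - found))"
    by (rule card_UN_le[OF finM])
  also have "\<dots> \<le> (\<Sum>\<mu>\<in>M. frobenius (active_tuple a (max_vector a) \<mu>))"
  proof (rule sum_mono)
    fix \<mu> assume "\<mu> \<in> M"
    show "card (weight ` {X \<in> F. type X = \<mu>} - found) \<le> frobenius (active_tuple a (max_vector a) \<mu>)"
    proof (cases "{X \<in> F. type X = \<mu>} = {}")
      case True
      thus ?thesis by (simp only: image_empty) simp
    next
      case False
      then obtain X0 where X0: "X0 \<in> F" "type X0 = \<mu>" by blast
      define \<tau> where "\<tau> x = min m (occ X0 x)" for x
      have "active_values a \<mu> = {x \<in> A. \<tau> x = m}"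
        unfolding X0(2)[symmetric] active_values_def active_set_def max_vector_def type_def \<tau>_def
          a(2)[symmetric] m by (auto simp: in_set_conv_nth)
      moreover have "{X \<in> F. type X = \<mu>} = {X \<in> F. \<forall>x\<in>A. min m (occ X x) = \<tau> x}"
        unfolding X0(2)[symmetric] type_def \<tau>_def a(2)[symmetric] by auto
      ultimately have "card (weight ` {X \<in> F. type X = \<mu>} - found) \<le> card (gaps (active_values a \<mu>))"
        using card_missed_le_card_gaps[of \<tau>] by simp
      also have "\<dots> \<le> frobenius (active_tuple a (max_vector a) \<mu>)"
        using a A by (intro card_gaps_le_frobenius_active_tuple) auto
      finally show ?thesis .
    qed
  qed
  finally show ?thesis by (simp add: r_value_def M_def)
qed

end

section \<open>Timed total correctness\<close>

text \<open>The loop counter is an array cell that runs from 0 to \<open>n\<close>, both included. Counters kept in array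
  cells can be addressed by computed indices, and admitting \<open>n\<close> itself does no harm in loops over
  coordinates: vectors are read off below index \<open>n\<close>, and the weight array is 0 at \<open>n\<close>.\<close>

definition for_loop :: "name \<Rightarrow> int \<Rightarrow> com \<Rightarrow> com" where
  "for_loop A i c = Seq (Store A (Const i) (Const 0))
     (While (Leq (Entry A (Const i)) (Var ''n''))
       (Seq c (Store A (Const i) (Plus (Entry A (Const i)) (Const 1)))))"

definition set_cell :: "name \<Rightarrow> int \<Rightarrow> int \<Rightarrow> state \<Rightarrow> state" where
  "set_cell A i c s = set_array A ((arrays s A)(i := c)) s"

lemma vars_set [simp]:
  "vars (set_var x c s) = (vars s)(x := c)" "vars (set_array A g s) = vars s"
  "vars (set_cell A i c s) = vars s" "vars (put_vec n A v s) = vars s"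
  by (simp_all add: set_var_def set_array_def set_cell_def put_vec_def)

lemma arrays_set [simp]:
  "arrays (set_var x c s) = arrays s" "arrays (set_array A g s) = (arrays s)(A := g)"
  "arrays (set_cell A i c s) = (arrays s)(A := (arrays s A)(i := c))"
  by (simp_all add: set_var_def set_array_def set_cell_def)

lemma arrays_put_vec [simp]:
  "arrays (put_vec n A v s) =
     (arrays s)(A := (\<lambda>i. if 0 \<le> i \<and> i < int n then v $ nat i else arrays s A i))"
  by (simp add: put_vec_def)

definition loop_time :: "nat \<Rightarrow> nat \<Rightarrow> nat" where
  "loop_time n t = 2 + (n + 1) * (t + 2)"

locale oracle_machine =
  fixes n :: nat and lin :: "int vec \<Rightarrow> int vec" and cmp :: "int \<Rightarrow> int \<Rightarrow> bool"
begin

definition reaches :: "com \<Rightarrow> nat \<Rightarrow> state \<Rightarrow> (state \<Rightarrow> bool) \<Rightarrow> bool" where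
  "reaches c t s Q \<longleftrightarrow> (\<exists>k s'. run n lin cmp c s k s' \<and> k \<le> t \<and> Q s')"

lemma reaches_mono:
  "reaches c t s Q \<Longrightarrow> t \<le> t' \<Longrightarrow> (\<And>s'. Q s' \<Longrightarrow> Q' s') \<Longrightarrow> reaches c t' s Q'"
  unfolding reaches_def by (meson order.trans)

lemma reaches_Skip: "Q s \<Longrightarrow> 1 \<le> t \<Longrightarrow> reaches Skip t s Q"
  unfolding reaches_def by (blast intro: run.Skip)

lemma reaches_Assign: "Q (set_var x (aval e s) s) \<Longrightarrow> 1 \<le> t \<Longrightarrow> reaches (Assign x e) t s Q"
  unfolding reaches_def by (blast intro: run.Assign)

lemma reaches_Store: "Q (set_cell A (aval i s) (aval e s) s) \<Longrightarrow> 1 \<le> t \<Longrightarrow> reaches (Store A i e) t s Q"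
  unfolding reaches_def set_cell_def by (blast intro: run.Store)

lemma reaches_LinOpt: "Q (put_vec n B (lin (get_vec n A s)) s) \<Longrightarrow> 1 \<le> t \<Longrightarrow> reaches (LinOpt A B) t s Q"
  unfolding reaches_def by (blast intro: run.LinOpt)

lemma reaches_Compare:
  "Q (set_var x (if cmp (aval e1 s) (aval e2 s) then 1 else 0) s) \<Longrightarrow> 1 \<le> t \<Longrightarrow> reaches (Compare x e1 e2) t s Q"
  unfolding reaches_def by (blast intro: run.Compare)

lemma reaches_Seq:
  "reaches c1 t1 s (\<lambda>s'. reaches c2 t2 s' Q) \<Longrightarrow> reaches (Seq c1 c2) (t1 + t2) s Q"
  unfolding reaches_def by (blast intro: run.Seq add_le_mono)

lemma reaches_If:
  assumes "bval b s \<Longrightarrow> reaches c1 t s Q" "\<not> bval b s \<Longrightarrow> reaches c2 t s Q"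
  shows "reaches (If b c1 c2) (1 + t) s Q"
  using assms unfolding reaches_def
  by (cases "bval b s") (auto intro: run.IfTrue run.IfFalse, (metis Suc_le_mono plus_1_eq_Suc run.IfTrue run.IfFalse)+)

text \<open>The invariant is required after the counter has been increased, so that it may speak about the
  counter's array.\<close>

lemma reaches_for_loop:
  assumes init: "Inv 0 (set_cell A i 0 s)"
    and step: "\<And>k s. k \<le> n \<Longrightarrow> Inv k s \<Longrightarrow> arrays s A i = int k \<Longrightarrow>
      reaches c t s (\<lambda>s'. arrays s' A i = int k \<and> Inv (Suc k) (set_cell A i (int (Suc k)) s'))"
    and fin: "\<And>s. Inv (Suc n) s \<Longrightarrow> Q s"
    and n: "\<And>k s. Inv k s \<Longrightarrow> vars s ''n'' = int n"
  shows "reaches (for_loop A i c) (loop_time n t) s Q"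
proof -
  let ?c = "Seq c (Store A (Const i) (Plus (Entry A (Const i)) (Const 1)))"
  let ?b = "Leq (Entry A (Const i)) (Var ''n'')"
  have while: "reaches (While ?b ?c) (1 + (n + 1 - k) * (t + 2)) s Q"
    if "k \<le> n + 1" "Inv k s" "arrays s A i = int k" for k s
    using that
  proof (induction "n + 1 - k" arbitrary: k s)
    case 0
    hence "k = Suc n" by simp
    moreover from this have "\<not> bval ?b s" using 0 n by simp
    ultimately show ?case using 0 fin unfolding reaches_def by (blast intro: run.WhileFalse le_add1)
  next
    case (Suc d)
    hence k: "k \<le> n" and d: "d = n + 1 - Suc k" by auto
    have "reaches ?c (t + 1) s (\<lambda>s'. Inv (Suc k) s' \<and> arrays s' A i = int (Suc k))"
      by (intro reaches_Seq reaches_mono[OF step[OF k Suc.prems(2,3)]] reaches_Store) (auto simp: add.commute)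
    then obtain l1 s1 where s1: "run n lin cmp ?c s l1 s1" "l1 \<le> t + 1" "Inv (Suc k) s1"
      "arrays s1 A i = int (Suc k)" unfolding reaches_def by blast
    have "reaches (While ?b ?c) (1 + (n + 1 - Suc k) * (t + 2)) s1 Q"
      using k s1 by (intro Suc.hyps(1)[OF d]) auto
    then obtain l2 s2 where s2: "run n lin cmp (While ?b ?c) s1 l2 s2"
      "l2 \<le> 1 + (n + 1 - Suc k) * (t + 2)" "Q s2" unfolding reaches_def by blast
    have "bval ?b s" using Suc.prems n k by simp
    from run.WhileTrue[OF this s1(1) s2(1)]
    have "run n lin cmp (While ?b ?c) s (1 + l1 + l2) s2" .
    moreover have "n + 1 - k = Suc (n + 1 - Suc k)" using k by simp
    hence "1 + l1 + l2 \<le> 1 + (n + 1 - k) * (t + 2)" using s1(2) s2(2) by simp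
    ultimately show ?case unfolding reaches_def using s2(3) by blast
  qed
  have "reaches (for_loop A i c) (1 + (1 + (n + 1 - 0) * (t + 2))) s Q"
    unfolding for_loop_def by (intro reaches_Seq reaches_Store while) (auto simp: init)
  thus ?thesis by (rule reaches_mono) (simp_all add: loop_time_def)
qed

end

section \<open>The program\<close>

text \<open>The counter of the loops over coordinates.\<close>

abbreviation J :: aexp where "J \<equiv> Entry ''j'' (Const 0)"

abbreviation weight_J :: aexp where "weight_J \<equiv> Entry ''w'' J"

primrec multiple :: "nat \<Rightarrow> aexp \<Rightarrow> aexp" where
  "multiple 0 e = Const 0"
| "multiple (Suc m) e = Plus e (multiple m e)"

primrec not_guessed :: "nat \<Rightarrow> bexp" where
  "not_guessed 0 = Leq (Const 0) (Const 0)"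
| "not_guessed (Suc K) = Conj (not_guessed K)
     (Neg (Conj (Leq J (Entry ''t'' (Const (int K)))) (Leq (Entry ''t'' (Const (int K))) J)))"

text \<open>The guess is kept in three arrays: \<open>t\<close> lists the elements of \<open>T\<close>, where an entry \<open>n\<close> stands for
  no element; \<open>u\<close> is the characteristic function of \<open>I\<close>; and \<open>b\<close> holds the thresholds. As \<open>u\<close> and
  \<open>b\<close> are addressed by weight values, they can be looked up at the weight of a coordinate.\<close>

definition set_query :: "nat \<Rightarrow> nat \<Rightarrow> com" where
  "set_query m K = for_loop ''j'' 0
     (If (Neg (not_guessed K)) (Store ''v'' J (Plus (Const 1) (multiple m (Var ''n''))))
       (If (Leq (Const 1) (Entry ''u'' weight_J)) (Store ''v'' J weight_J) (Store ''v'' J (Const 0))))"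

text \<open>The set \<open>select T I \<nu>\<close> is written into array \<open>z\<close> and its weight is accumulated on the way, which
  takes the place of a multiplication. Padding with \<^const>\<open>Skip\<close> gives both branches the same length.\<close>

definition choose_below :: "nat \<Rightarrow> com" where
  "choose_below K = for_loop ''j'' 0
     (If (Conj (Conj (Leq (Const 1) (Entry ''y'' J)) (Leq (Plus J (Const 1)) (Entry ''b'' weight_J)))
           (Neg (Conj (not_guessed K) (Neg (Leq (Const 1) (Entry ''u'' weight_J))))))
       (Seq (Store ''z'' J (Const 1)) (Assign ''val'' (Plus (Var ''val'') weight_J)))
       (Seq (Store ''z'' J (Const 0)) Skip))"

text \<open>No solution has to be stored initially: array \<open>x\<close> starts as the zero vector, which is feasible
  and has the value 0, the initial value of \<open>best\<close>.\<close>

definition keep_better :: com where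
  "keep_better = Seq (Compare ''c'' (Var ''val'') (Var ''best''))
     (If (Leq (Const 1) (Var ''c''))
       (Seq (for_loop ''j'' 0 (Store ''x'' J (Entry ''z'' J))) (Assign ''best'' (Var ''val'')))
       Skip)"

definition test_guess :: "nat \<Rightarrow> nat \<Rightarrow> com" where
  "test_guess m K = Seq (set_query m K) (Seq (LinOpt ''v'' ''y'')
     (Seq (Assign ''val'' (Const 0)) (Seq (choose_below K) keep_better)))"

definition nested_loops :: "(name \<times> int) list \<Rightarrow> com \<Rightarrow> com" where
  "nested_loops cs c = foldr (\<lambda>(A, i). for_loop A i) cs c"

text \<open>The bracketing mirrors the nesting of the sequential compositions, which the rules for runs
  follow.\<close>

definition test_guess_time :: "nat \<Rightarrow> nat" where
  "test_guess_time n = loop_time n 3 + (1 + (1 + (loop_time n 3 + (1 + (1 + (loop_time n 1 + 1))))))"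

primrec nested_loops_time :: "nat \<Rightarrow> nat \<Rightarrow> nat" where
  "nested_loops_time n 0 = test_guess_time n"
| "nested_loops_time n (Suc d) = loop_time n (nested_loops_time n d)"

text \<open>For a fixed tuple \<open>a\<close> the number of cells is a constant, so nested loops over them take polynomial
  time.\<close>

definition guess_cells :: "nat list \<Rightarrow> nat \<Rightarrow> (name \<times> int) list" where
  "guess_cells a K = map (\<lambda>k. (''t'', int k)) [0..<K] @
     map (\<lambda>x. (''u'', int x)) a @ map (\<lambda>x. (''b'', int x)) a"

text \<open>A guess is described by the contents of the arrays \<open>t\<close>, \<open>u\<close> and \<open>b\<close>. With the type of
  \<open>arrays s\<close> for guesses, the guess that a state holds is \<open>arrays s\<close> itself.\<close>

type_synonym valuation = "name \<Rightarrow> int \<Rightarrow> int"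

definition weight_array :: "nat \<Rightarrow> int vec \<Rightarrow> int \<Rightarrow> int" where
  "weight_array n w i = (if 0 \<le> i \<and> i < int n then w $ nat i else 0)"

definition guessed :: "nat \<Rightarrow> valuation \<Rightarrow> int \<Rightarrow> bool" where
  "guessed K \<sigma> j \<longleftrightarrow> (\<exists>k<K. \<sigma> ''t'' (int k) = j)"

definition query_entry :: "nat \<Rightarrow> nat \<Rightarrow> nat \<Rightarrow> (int \<Rightarrow> int) \<Rightarrow> valuation \<Rightarrow> int \<Rightarrow> int" where
  "query_entry n m K W \<sigma> j =
    (if guessed K \<sigma> j then 1 + int m * int n else if 1 \<le> \<sigma> ''u'' (W j) then W j else 0)"

definition chosen :: "nat \<Rightarrow> (int \<Rightarrow> int) \<Rightarrow> valuation \<Rightarrow> (int \<Rightarrow> int) \<Rightarrow> int \<Rightarrow> bool" where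
  "chosen K W \<sigma> y j \<longleftrightarrow> 1 \<le> y j \<and> j + 1 \<le> \<sigma> ''b'' (W j) \<and> (guessed K \<sigma> j \<or> 1 \<le> \<sigma> ''u'' (W j))"

lemma aval_multiple [simp]: "aval (multiple m e) s = int m * aval e s"
  by (induction m) (auto simp: algebra_simps)

lemma bval_not_guessed [simp]:
  "bval (not_guessed K) s \<longleftrightarrow> \<not> guessed K (arrays s) (arrays s ''j'' 0)"
  by (induction K) (auto simp: guessed_def less_Suc_eq)

section \<open>What the program achieves\<close>

context oracle_machine
begin

lemma reaches_set_query:
  assumes n: "vars s0 ''n'' = int n"
    and Q: "\<And>s. vars s = vars s0 \<Longrightarrow> \<forall>A. A \<noteq> ''j'' \<and> A \<noteq> ''v'' \<longrightarrow> arrays s A = arrays s0 A \<Longrightarrow>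
      get_vec n ''v'' s = vec n (\<lambda>j. query_entry n m K (arrays s0 ''w'') (arrays s0) (int j)) \<Longrightarrow> Q s"
  shows "reaches (set_query m K) (loop_time n 3) s0 Q"
proof -
  let ?q = "query_entry n m K (arrays s0 ''w'') (arrays s0)"
  define Inv where "Inv k s \<longleftrightarrow> vars s = vars s0 \<and>
    (\<forall>A. A \<noteq> ''j'' \<and> A \<noteq> ''v'' \<longrightarrow> arrays s A = arrays s0 A) \<and>
    (\<forall>j<k. arrays s ''v'' (int j) = ?q (int j))" for k :: nat and s
  have "reaches (set_query m K) (loop_time n (1 + (1 + 1))) s0 Q"
    unfolding set_query_def
  proof (rule reaches_for_loop[where Inv = Inv], goal_cases)
    case (2 k s)
    hence frame: "arrays s A = arrays s0 A" if "A \<noteq> ''j''" "A \<noteq> ''v''" for A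
      using that by (simp add: Inv_def)
    have guessed: "guessed K (arrays s) = guessed K (arrays s0)"
      by (simp add: guessed_def frame fun_eq_iff)
    have q: "?q (int k) = (if guessed K (arrays s) (int k) then 1 + int m * int n
        else if 1 \<le> arrays s ''u'' (arrays s ''w'' (int k)) then arrays s ''w'' (int k) else 0)"
      by (simp add: query_entry_def guessed frame)
    have Inv: "Inv (Suc k) (set_cell ''j'' 0 (int (Suc k)) (set_cell ''v'' (int k) (?q (int k)) s))"
      using 2 by (simp add: Inv_def less_Suc_eq)
    have "vars s ''n'' = int n" using 2 n by (simp add: Inv_def)
    thus ?case using 2(3) Inv unfolding q
      by (intro reaches_If reaches_Store) simp_all
  next
    case (3 s)
    hence "get_vec n ''v'' s = vec n (\<lambda>j. ?q (int j))"
      unfolding get_vec_def by (intro eq_vecI) (simp_all add: Inv_def)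
    with 3 show ?case by (intro Q) (simp_all add: Inv_def)
  qed (use n in \<open>auto simp: Inv_def\<close>)
  thus ?thesis by (simp add: numeral_3_eq_3)
qed

lemma reaches_choose_below:
  fixes s0 :: state and K :: nat
  defines "ch \<equiv> chosen K (arrays s0 ''w'') (arrays s0) (arrays s0 ''y'')"
  assumes n: "vars s0 ''n'' = int n" and val: "vars s0 ''val'' = 0" and wn: "arrays s0 ''w'' (int n) = 0"
    and Q: "\<And>s. \<forall>x. x \<noteq> ''val'' \<longrightarrow> vars s x = vars s0 x \<Longrightarrow>
      \<forall>A. A \<noteq> ''j'' \<and> A \<noteq> ''z'' \<longrightarrow> arrays s A = arrays s0 A \<Longrightarrow>
      get_vec n ''z'' s = vec n (\<lambda>j. if ch (int j) then 1 else 0) \<Longrightarrow>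
      vars s ''val'' = (\<Sum>j<n. if ch (int j) then arrays s0 ''w'' (int j) else 0) \<Longrightarrow> Q s"
  shows "reaches (choose_below K) (loop_time n 3) s0 Q"
proof -
  let ?w = "arrays s0 ''w''"
  define Inv where "Inv k s \<longleftrightarrow> (\<forall>x. x \<noteq> ''val'' \<longrightarrow> vars s x = vars s0 x) \<and>
    (\<forall>A. A \<noteq> ''j'' \<and> A \<noteq> ''z'' \<longrightarrow> arrays s A = arrays s0 A) \<and>
    (\<forall>j<k. arrays s ''z'' (int j) = (if ch (int j) then 1 else 0)) \<and>
    vars s ''val'' = (\<Sum>j<k. if ch (int j) then ?w (int j) else 0)" for k :: nat and s
  have "reaches (choose_below K) (loop_time n (1 + (1 + 1))) s0 Q"
    unfolding choose_below_def
  proof (rule reaches_for_loop[where Inv = Inv], goal_cases)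
    case (2 k s)
    let ?b = "Conj (Conj (Leq (Const 1) (Entry ''y'' J)) (Leq (Plus J (Const 1)) (Entry ''b'' weight_J)))
           (Neg (Conj (not_guessed K) (Neg (Leq (Const 1) (Entry ''u'' weight_J)))))"
    have frame: "arrays s A = arrays s0 A" if "A \<noteq> ''j''" "A \<noteq> ''z''" for A
      using 2 that by (simp add: Inv_def)
    have "guessed K (arrays s) = guessed K (arrays s0)"
      by (simp add: guessed_def frame fun_eq_iff)
    hence b: "bval ?b s \<longleftrightarrow> ch (int k)"
      using 2(3) by (auto simp: frame ch_def chosen_def)
    show ?case
    proof (rule reaches_If)
      assume "bval ?b s"
      hence "ch (int k)" using b by blast
      thus "reaches (Seq (Store ''z'' J (Const 1)) (Assign ''val'' (Plus (Var ''val'') weight_J))) (1 + 1) s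
          (\<lambda>s'. arrays s' ''j'' 0 = int k \<and> Inv (Suc k) (set_cell ''j'' 0 (int (Suc k)) s'))"
        using 2 by (intro reaches_Seq reaches_Store reaches_Assign) (simp_all add: Inv_def less_Suc_eq)
    next
      assume "\<not> bval ?b s"
      hence "\<not> ch (int k)" using b by blast
      thus "reaches (Seq (Store ''z'' J (Const 0)) Skip) (1 + 1) s
          (\<lambda>s'. arrays s' ''j'' 0 = int k \<and> Inv (Suc k) (set_cell ''j'' 0 (int (Suc k)) s'))"
        using 2 by (intro reaches_Seq reaches_Store reaches_Skip) (simp_all add: Inv_def less_Suc_eq)
    qed
  next
    case (3 s)
    hence "get_vec n ''z'' s = vec n (\<lambda>j. if ch (int j) then 1 else 0)"
      unfolding get_vec_def by (intro eq_vecI) (simp_all add: Inv_def)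
    with 3 wn show ?case by (intro Q) (simp_all add: Inv_def)
  qed (use n val in \<open>auto simp: Inv_def\<close>)
  thus ?thesis by (simp add: numeral_3_eq_3)
qed

lemma reaches_keep_better:
  assumes n: "vars s0 ''n'' = int n"
    and Q: "\<And>s. vars s ''n'' = int n \<Longrightarrow>
      \<forall>A. A \<noteq> ''j'' \<and> A \<noteq> ''x'' \<longrightarrow> arrays s A = arrays s0 A \<Longrightarrow>
      (if cmp (vars s0 ''val'') (vars s0 ''best'')
       then get_vec n ''x'' s = get_vec n ''z'' s0 \<and> vars s ''best'' = vars s0 ''val''
       else get_vec n ''x'' s = get_vec n ''x'' s0 \<and> vars s ''best'' = vars s0 ''best'') \<Longrightarrow> Q s"
  shows "reaches keep_better (1 + (1 + (loop_time n 1 + 1))) s0 Q"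
proof -
  let ?c = "if cmp (vars s0 ''val'') (vars s0 ''best'') then 1 else 0 :: int"
  define Inv where "Inv k s \<longleftrightarrow> vars s = (vars s0)(''c'' := ?c) \<and>
    (\<forall>A. A \<noteq> ''j'' \<and> A \<noteq> ''x'' \<longrightarrow> arrays s A = arrays s0 A) \<and>
    (\<forall>j<k. arrays s ''x'' (int j) = arrays s0 ''z'' (int j))" for k :: nat and s
  show ?thesis unfolding keep_better_def
  proof (intro reaches_Seq reaches_Compare reaches_If, goal_cases)
    case 1
    hence cmp: "cmp (vars s0 ''val'') (vars s0 ''best'')" by (auto split: if_splits)
    show ?case
    proof (rule reaches_for_loop[where Inv = Inv], goal_cases)
      case (2 k s)
      thus ?case by (intro reaches_Store) (auto simp: Inv_def less_Suc_eq)
    next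
      case (3 s)
      hence v: "vars s = (vars s0)(''c'' := ?c)"
        and fr: "\<forall>A. A \<noteq> ''j'' \<and> A \<noteq> ''x'' \<longrightarrow> arrays s A = arrays s0 A"
        and x: "\<And>j. j < n \<Longrightarrow> arrays s ''x'' (int j) = arrays s0 ''z'' (int j)"
        by (simp_all add: Inv_def)
      have "get_vec n ''x'' s = get_vec n ''z'' s0"
        unfolding get_vec_def by (rule eq_vecI) (simp_all add: x)
      hence g: "get_vec n ''x'' (set_var ''best'' (aval (Var ''val'') s) s) = get_vec n ''z'' s0"
        by (simp add: get_vec_def)
      show ?case
        by (intro reaches_Assign Q) (use cmp n v fr g in simp_all)
    qed (use n in \<open>auto simp: Inv_def\<close>)
  next
    case 2
    hence "\<not> cmp (vars s0 ''val'') (vars s0 ''best'')" by (auto split: if_splits)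
    thus ?case using n by (intro reaches_Skip Q) (simp_all add: get_vec_def)
  qed simp
qed


end

definition query :: "nat \<Rightarrow> nat \<Rightarrow> nat \<Rightarrow> int vec \<Rightarrow> valuation \<Rightarrow> int vec" where
  "query n m K w \<sigma> = vec n (\<lambda>j. query_entry n m K (weight_array n w) \<sigma> (int j))"

definition candidate ::
    "nat \<Rightarrow> nat \<Rightarrow> nat \<Rightarrow> (int vec \<Rightarrow> int vec) \<Rightarrow> int vec \<Rightarrow> valuation \<Rightarrow> int vec" where
  "candidate n m K lin w \<sigma> = vec n (\<lambda>j.
     if chosen K (weight_array n w) \<sigma> (weight_array n (lin (query n m K w \<sigma>))) (int j) then 1 else 0)"

lemma candidate_cong:
  assumes "\<And>A. A \<in> {''t'', ''u'', ''b''} \<Longrightarrow> \<sigma> A = \<sigma>' A"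
  shows "candidate n m K lin w \<sigma> = candidate n m K lin w \<sigma>'"
proof -
  have "guessed K \<sigma> = guessed K \<sigma>'" using assms by (simp add: guessed_def fun_eq_iff)
  moreover have "\<sigma> ''u'' = \<sigma>' ''u''" "\<sigma> ''b'' = \<sigma>' ''b''" using assms by blast+
  ultimately have "query_entry n m K W \<sigma> = query_entry n m K W \<sigma>'" "chosen K W \<sigma> = chosen K W \<sigma>'" for W
    by (auto simp: query_entry_def chosen_def fun_eq_iff)
  thus ?thesis by (simp add: candidate_def query_def)
qed

locale optimization_run = oracle_machine n lin "comparison_oracle f"
  for n lin and f :: "int \<Rightarrow> real" +
  fixes m K :: nat and S :: "int vec set" and w :: "int vec"
  assumes independence: "independence_system n S"
    and maximizer: "linear_optimization_oracle n S lin"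
    and w: "w \<in> carrier_vec n"
begin

text \<open>A candidate lies below an answer of the linear-optimization oracle, whatever the guess was; so wrong
  guesses are harmless.\<close>

lemma candidate_in_S: "candidate n m K lin w \<sigma> \<in> S"
proof -
  let ?q = "query n m K w \<sigma>"
  have y: "lin ?q \<in> S" using maximizer by (simp add: linear_optimization_oracle_def query_def)
  hence yz: "lin ?q \<in> zero_one_vecs n" using independence by (auto simp: independence_system_def)
  hence "candidate n m K lin w \<sigma> \<le> lin ?q"
    by (auto simp: candidate_def less_eq_vec_def zero_one_vecs_def chosen_def weight_array_def)
  moreover have "candidate n m K lin w \<sigma> \<in> zero_one_vecs n"
    by (auto simp: candidate_def zero_one_vecs_def)
  ultimately show ?thesis using y independence by (auto simp: independence_system_def)
qed

definition sound :: "state \<Rightarrow> bool" where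
  "sound s \<longleftrightarrow> vars s ''n'' = int n \<and> arrays s ''w'' = weight_array n w \<and>
     get_vec n ''x'' s \<in> S \<and> vars s ''best'' = w \<bullet> get_vec n ''x'' s"

lemma reaches_test_guess:
  assumes s0: "sound s0"
  shows "reaches (test_guess m K) (test_guess_time n) s0 (\<lambda>s. sound s \<and>
    (\<forall>A\<in>{''t'', ''u'', ''b''}. arrays s A = arrays s0 A) \<and>
    f (vars s ''best'') \<le> f (vars s0 ''best'') \<and>
    f (vars s ''best'') \<le> f (w \<bullet> candidate n m K lin w (arrays s0)))"
proof -
  let ?W = "weight_array n w"
  let ?q = "query n m K w (arrays s0)"
  let ?Z = "candidate n m K lin w (arrays s0)"
  let ?ch = "chosen K ?W (arrays s0) (weight_array n (lin ?q))"
  have n: "vars s0 ''n'' = int n" and W: "arrays s0 ''w'' = ?W"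
    using s0 by (simp_all add: sound_def)
  have val: "w \<bullet> ?Z = (\<Sum>j<n. if ?ch (int j) then ?W (int j) else 0)"
    unfolding scalar_prod_def candidate_def
    by (simp add: atLeast0LessThan) (intro sum.cong, auto simp: weight_array_def)
  show ?thesis unfolding test_guess_def test_guess_time_def
  proof (intro reaches_Seq reaches_set_query reaches_LinOpt reaches_Assign, goal_cases)
    case (2 s1)
    define s2 where "s2 = set_var ''val'' 0 (put_vec n ''y'' (lin ?q) s1)"
    have q: "get_vec n ''v'' s1 = ?q" using 2 W by (simp add: query_def)
    have y: "chosen K (arrays s2 ''w'') (arrays s2) (arrays s2 ''y'') (int j) = ?ch (int j)" if "j < n" for j
      using 2(2) W that by (simp add: s2_def chosen_def guessed_def weight_array_def)
    have fr2: "arrays s2 A = arrays s0 A" if "A \<in> {''w'', ''t'', ''u'', ''b'', ''x''}" for A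
    proof -
      have "A \<noteq> ''j'' \<and> A \<noteq> ''v'' \<and> A \<noteq> ''y''" using that by auto
      thus ?thesis using 2(2) by (simp add: s2_def)
    qed
    have v2: "vars s2 = (vars s0)(''val'' := 0)" using 2(1) by (simp add: s2_def)
    have "reaches (choose_below K) (loop_time n 3) s2
       (\<lambda>s. reaches keep_better (1 + (1 + (loop_time n 1 + 1))) s (\<lambda>s. sound s \<and>
    (\<forall>A\<in>{''t'', ''u'', ''b''}. arrays s A = arrays s0 A) \<and>
    f (vars s ''best'') \<le> f (vars s0 ''best'') \<and>
    f (vars s ''best'') \<le> f (w \<bullet> ?Z)))"
    proof (rule reaches_choose_below, goal_cases)
      case (4 s3)
      have fr3: "arrays s3 A = arrays s0 A" if "A \<in> {''w'', ''t'', ''u'', ''b'', ''x''}" for A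
      proof -
        have "A \<noteq> ''j'' \<and> A \<noteq> ''z''" using that by auto
        thus ?thesis using 4(2) fr2[OF that] by simp
      qed
      have v3: "vars s3 ''n'' = int n" "vars s3 ''best'' = vars s0 ''best''" using 4(1) v2 n by simp_all
      have z: "get_vec n ''z'' s3 = ?Z"
        unfolding 4(3) candidate_def by (rule eq_vecI) (simp_all add: y)
      have val3: "vars s3 ''val'' = w \<bullet> ?Z"
        unfolding 4(4) val using y W by (intro sum.cong) (simp_all add: fr2)
      have x3: "get_vec n ''x'' s3 = get_vec n ''x'' s0" by (simp add: get_vec_def fr3)
      show ?case
      proof (rule reaches_keep_better, goal_cases)
        case (2 s4)
        have fr4: "arrays s4 A = arrays s0 A" if "A \<in> {''w'', ''t'', ''u'', ''b''}" for A
        proof -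
          have "A \<noteq> ''j'' \<and> A \<noteq> ''x''" using that by auto
          thus ?thesis using 2(2) fr3[of A] that by simp
        qed
        show ?case
        proof (cases "comparison_oracle f (vars s3 ''val'') (vars s3 ''best'')")
          case True
          hence "get_vec n ''x'' s4 = ?Z" "vars s4 ''best'' = w \<bullet> ?Z" using 2(3) z val3 by auto
          thus ?thesis using True 2(1) fr4 W candidate_in_S
            by (simp add: sound_def comparison_oracle_def val3 v3)
        next
          case False
          hence "get_vec n ''x'' s4 = get_vec n ''x'' s0" "vars s4 ''best'' = vars s0 ''best''"
            using 2(3) x3 v3 by auto
          thus ?thesis using False 2(1) fr4 s0
            by (simp add: sound_def comparison_oracle_def val3 v3)
        qed
      qed (simp add: v3)
    qed (use n W fr2 v2 in \<open>simp_all add: weight_array_def\<close>)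
    thus ?case by (simp add: s2_def q)
  qed (simp_all add: n)
qed

text \<open>The cells outside \<open>cs\<close> are left alone, so the loops run through exactly those valuations that agree
  with the initial one outside \<open>cs\<close>.\<close>

lemma reaches_nested_loops:
  assumes "distinct cs" "fst ` set cs \<subseteq> {''t'', ''u'', ''b''}" "sound s0"
  shows "reaches (nested_loops cs (test_guess m K)) (nested_loops_time n (length cs)) s0 
    (\<lambda>s. sound s \<and>
    (\<forall>A\<in>{''t'', ''u'', ''b''}. \<forall>i. (A, i) \<notin> set cs \<longrightarrow> arrays s A i = arrays s0 A i) \<and>
    f (vars s ''best'') \<le> f (vars s0 ''best'') \<and>
    (\<forall>\<sigma>. (\<forall>(A, i)\<in>set cs. 0 \<le> \<sigma> A i \<and> \<sigma> A i \<le> int n) \<longrightarrow>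
       (\<forall>A\<in>{''t'', ''u'', ''b''}. \<forall>i. (A, i) \<notin> set cs \<longrightarrow> \<sigma> A i = arrays s0 A i) \<longrightarrow>
       f (vars s ''best'') \<le> f (w \<bullet> candidate n m K lin w \<sigma>)))"
  using assms
proof (induction cs arbitrary: s0)
  case Nil
  show ?case unfolding nested_loops_def foldr.simps id_apply list.size nested_loops_time.simps
  proof (rule reaches_mono[OF reaches_test_guess[OF Nil(3)] order_refl], intro conjI allI impI, goal_cases)
    case (4 s \<sigma>)
    have "candidate n m K lin w \<sigma> = candidate n m K lin w (arrays s0)"
      using 4(3) by (intro candidate_cong) auto
    thus ?case using 4(1) by simp
  qed (auto simp del: insert_iff)
next
  case (Cons c cs)
  obtain B i where c: "c = (B, i)" by fastforce
  have B: "B \<in> {''t'', ''u'', ''b''}" and new: "(B, i) \<notin> set cs" using Cons.prems c by auto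
  define Inv where "Inv k s \<longleftrightarrow> sound s \<and>
    (\<forall>A\<in>{''t'', ''u'', ''b''}. \<forall>i. (A, i) \<notin> set (c # cs) \<longrightarrow> arrays s A i = arrays s0 A i) \<and>
    f (vars s ''best'') \<le> f (vars s0 ''best'') \<and>
    (\<forall>\<sigma>. (\<forall>(A, i)\<in>set (c # cs). 0 \<le> \<sigma> A i \<and> \<sigma> A i \<le> int n) \<longrightarrow>
       (\<forall>A\<in>{''t'', ''u'', ''b''}. \<forall>i. (A, i) \<notin> set (c # cs) \<longrightarrow> \<sigma> A i = arrays s0 A i) \<longrightarrow>
       \<sigma> B i < int k \<longrightarrow> f (vars s ''best'') \<le> f (w \<bullet> candidate n m K lin w \<sigma>))" for k :: nat and s
  have sound_cell: "sound (set_cell B i v s) \<longleftrightarrow> sound s" for v s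
    using B by (auto simp: sound_def get_vec_def)
  have Inv_cell: "Inv k (set_cell B i v s) \<longleftrightarrow> Inv k s" for k v s
    unfolding Inv_def sound_cell by (simp add: c)
  have "reaches (for_loop B i (nested_loops cs (test_guess m K)))
      (loop_time n (nested_loops_time n (length cs))) s0
      (\<lambda>s. Inv (Suc n) s)"
  proof (rule reaches_for_loop[where Inv = Inv], goal_cases)
    case 1
    show ?case unfolding Inv_cell using Cons.prems(3) by (simp add: Inv_def c)
  next
    case (2 k s)
    have s: "sound s" using 2 by (simp add: Inv_def)
    show ?case unfolding Inv_cell
    proof (rule reaches_mono[OF Cons.IH[OF _ _ s] order_refl], goal_cases)
      case (3 s')
      have "\<forall>A\<in>{''t'', ''u'', ''b''}. \<forall>i. (A, i) \<notin> set cs \<longrightarrow> arrays s' A i = arrays s A i" using 3 by blast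
      from this[rule_format, OF B new] have k: "arrays s' B i = int k" using 2(3) by simp
      have fr: "\<forall>A\<in>{''t'', ''u'', ''b''}. \<forall>i. (A, i) \<notin> set (c # cs) \<longrightarrow> arrays s' A i = arrays s0 A i"
        using 3 2(2) unfolding Inv_def by simp
      have le: "f (vars s' ''best'') \<le> f (vars s ''best'')" using 3 by blast
      have "f (vars s' ''best'') \<le> f (w \<bullet> candidate n m K lin w \<sigma>)"
        if \<sigma>: "\<forall>(A, i)\<in>set (c # cs). 0 \<le> \<sigma> A i \<and> \<sigma> A i \<le> int n"
          "\<forall>A\<in>{''t'', ''u'', ''b''}. \<forall>i. (A, i) \<notin> set (c # cs) \<longrightarrow> \<sigma> A i = arrays s0 A i"
          "\<sigma> B i < int (Suc k)" for \<sigma>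
      proof (cases "\<sigma> B i < int k")
        case True
        hence "f (vars s ''best'') \<le> f (w \<bullet> candidate n m K lin w \<sigma>)"
          using 2(2) \<sigma>(1,2) unfolding Inv_def by blast
        thus ?thesis using le by linarith
      next
        case False
        hence eq: "\<sigma> B i = int k" using \<sigma>(3) by simp
        have "\<sigma> A i' = arrays s A i'" if "A \<in> {''t'', ''u'', ''b''}" "(A, i') \<notin> set cs" for A i'
        proof (cases "(A, i') = c")
          case True
          thus ?thesis using eq 2(3) c by simp
        next
          case False
          hence out: "(A, i') \<notin> set (c # cs)" using that(2) by simp
          have "\<forall>A\<in>{''t'', ''u'', ''b''}. \<forall>i. (A, i) \<notin> set (c # cs) \<longrightarrow> arrays s A i = arrays s0 A i"
            using 2(2) unfolding Inv_def by blast
          from this[rule_format, OF that(1) out] \<sigma>(2)[rule_format, OF that(1) out]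
          show ?thesis by simp
        qed
        moreover have "\<forall>(A, i)\<in>set cs. 0 \<le> \<sigma> A i \<and> \<sigma> A i \<le> int n" using \<sigma>(1) by simp
        ultimately show ?thesis using 3 by blast
      qed
      moreover have "f (vars s ''best'') \<le> f (vars s0 ''best'')" using 2(2) by (simp add: Inv_def)
      ultimately show ?case using 3 k fr le unfolding Inv_def by (meson order.trans)
    qed (use Cons.prems in auto)
  next
    case (4 k s)
    thus ?case by (simp add: Inv_def sound_def)
  qed
  thus ?case unfolding c nested_loops_def
    by (simp, rule reaches_mono[OF _ order_refl]) (auto simp: Inv_def c)
qed

end

section \<open>Polynomial time\<close>

definition polynomially :: "(nat \<Rightarrow> nat) \<Rightarrow> bool" where
  "polynomially t \<longleftrightarrow> (\<exists>q. \<forall>n. t n = poly q n)"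

lemma polynomially_const: "polynomially (\<lambda>n. c)"
  unfolding polynomially_def by (intro exI[of _ "[:c:]"]) simp

lemma polynomially_id: "polynomially (\<lambda>n. n)"
  unfolding polynomially_def by (intro exI[of _ "[:0, 1:]"]) simp

lemma polynomially_add: "polynomially t \<Longrightarrow> polynomially u \<Longrightarrow> polynomially (\<lambda>n. t n + u n)"
  unfolding polynomially_def by (metis poly_add)

lemma polynomially_mult: "polynomially t \<Longrightarrow> polynomially u \<Longrightarrow> polynomially (\<lambda>n. t n * u n)"
  unfolding polynomially_def by (metis poly_mult)

lemma polynomially_loop_time: "polynomially t \<Longrightarrow> polynomially (\<lambda>n. loop_time n (t n))"
  unfolding loop_time_def
  by (intro polynomially_add polynomially_mult polynomially_const polynomially_id)

lemma polynomially_nested_loops_time: "polynomially (\<lambda>n. nested_loops_time n d)"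
proof (induction d)
  case 0
  show ?case unfolding nested_loops_time.simps test_guess_time_def
    by (intro polynomially_add polynomially_loop_time polynomially_const)
qed (simp add: polynomially_loop_time)

section \<open>From oracles to weighted families\<close>

text \<open>Zero-one vectors are identified with the sets of coordinates at which they are 1.\<close>

definition support :: "int vec \<Rightarrow> nat set" where
  "support x = {j. j < dim_vec x \<and> x $ j = 1}"

lemma scalar_prod_zero_one:
  assumes "x \<in> zero_one_vecs n"
  shows "v \<bullet> x = (\<Sum>j\<in>support x. v $ j)"
proof -
  have x: "dim_vec x = n" "\<And>j. j < n \<Longrightarrow> x $ j = 0 \<or> x $ j = 1"
    using assms by (auto simp: zero_one_vecs_def)
  have "v \<bullet> x = (\<Sum>j<n. if x $ j = 1 then v $ j else 0)"
    unfolding scalar_prod_def x(1) atLeast0LessThan using x(2) by (intro sum.cong) auto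
  also have "\<dots> = (\<Sum>j | j \<in> {..<n} \<and> x $ j = 1. v $ j)" by (rule sum.inter_filter[symmetric]) simp
  also have "{j. j \<in> {..<n} \<and> x $ j = 1} = support x" by (auto simp: support_def x(1))
  finally show ?thesis .
qed

locale problem_instance =
  fixes a :: "nat list" and n :: nat and S :: "int vec set" and w :: "int vec"
    and f :: "int \<Rightarrow> real" and lin :: "int vec \<Rightarrow> int vec"
  assumes primitive: "primitive_tuple a"
    and independence: "independence_system n S"
    and maximizer: "linear_optimization_oracle n S lin"
    and w: "w \<in> carrier_vec n" and weights: "\<forall>j<n. w $ j \<in> int ` set a"
begin

definition m :: nat where "m = Max (set a)"

definition K :: nat where "K = length a * m"

definition W :: "nat \<Rightarrow> nat" where "W j = nat (w $ j)"

text \<open>The oracle query that belongs to a guess. The bonus \<open>1 + m * n\<close> exceeds the total weight of any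
  \<open>n\<close> coordinates.\<close>

definition preference :: "nat set \<Rightarrow> nat set \<Rightarrow> int vec" where
  "preference T I = vec n (\<lambda>j. int (if j \<in> T then 1 + m * n else if W j \<in> I then W j else 0))"

lemma a: "distinct a" "x \<in> set a \<Longrightarrow> 0 < x \<and> x \<le> m" "set a \<noteq> {}" "card (set a) = length a"
  using primitive by (auto simp: primitive_tuple_def m_def distinct_card)

lemma entry: "j < n \<Longrightarrow> w $ j = int (W j) \<and> W j \<in> set a"
  using weights by (force simp: W_def)

lemma S: "x \<in> S \<Longrightarrow> x \<in> zero_one_vecs n"
  using independence by (auto simp: independence_system_def)

lemma support_subset: "x \<in> S \<Longrightarrow> support x \<subseteq> {..<n}"
  using S by (force simp: support_def zero_one_vecs_def)

lemma lin_in_S: "lin (preference T I) \<in> S"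
  using maximizer by (simp add: linear_optimization_oracle_def preference_def)

lemma preference_value:
  assumes "x \<in> S"
  shows "preference T I \<bullet> x = int (\<Sum>j\<in>support x. if j \<in> T then 1 + m * n else if W j \<in> I then W j else 0)"
  unfolding scalar_prod_zero_one[OF S[OF assms]] of_nat_sum
  using support_subset[OF assms] by (intro sum.cong) (auto simp: preference_def)

sublocale weighted_family n m "1 + m * n" "set a" W "support ` S" "\<lambda>T I. support (lin (preference T I))"
proof (unfold_locales, goal_cases)
  case (7 T I X)
  then obtain x where x: "x \<in> S" "X = support x" by blast
  have "preference T I \<bullet> x \<le> preference T I \<bullet> lin (preference T I)"
    using maximizer x(1) by (simp add: linear_optimization_oracle_def preference_def)
  thus ?case unfolding preference_value[OF x(1)] preference_value[OF lin_in_S] x(2) by linarith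
qed (use a(2) entry support_subset lin_in_S in \<open>auto simp: mult.commute\<close>)

sublocale optimization_run n lin f m K S w
  by unfold_locales (fact independence maximizer w)+

lemma value_eq_weight:
  assumes "x \<in> S"
  shows "w \<bullet> x = int (weight (support x))"
  unfolding scalar_prod_zero_one[OF S[OF assms]] weight_def of_nat_sum
  using support_subset[OF assms] entry by (intro sum.cong) auto

text \<open>Encode \<open>T\<close>, \<open>I\<close> and \<open>\<nu>\<close> as array contents that the nested loops reach: a list of the elements of
  \<open>T\<close> padded with \<open>n\<close>, a flag and a threshold per weight value, and zeros elsewhere, as in the input
  state.\<close>

lemma found_is_candidate:
  assumes "u \<in> found"
  obtains \<sigma> where "\<forall>(A, i)\<in>set (guess_cells a K). 0 \<le> \<sigma> A i \<and> \<sigma> A i \<le> int n"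
    "\<forall>A\<in>{''t'', ''u'', ''b''}. \<forall>i. (A, i) \<notin> set (guess_cells a K) \<longrightarrow> \<sigma> A i = 0"
    "w \<bullet> candidate n m K lin w \<sigma> = int u"
proof -
  obtain T I \<nu> where T: "T \<subseteq> {..<n}" "card T \<le> K" and I: "I \<subseteq> set a" "I \<noteq> {} \<longrightarrow> n > 0"
    and \<nu>: "\<forall>x. \<nu> x \<le> n" and u: "u = weight (select T I \<nu>)"
    using assms by (auto simp: found_def K_def a(4))
  have finT: "finite T" using T(1) finite_subset by blast
  then obtain ts where ts: "set ts = T" "length ts = card T"
    by (metis finite_distinct_list distinct_card)
  define \<sigma> :: valuation where "\<sigma> A i =
    (if A = ''t'' \<and> 0 \<le> i \<and> i < int K then if nat i < length ts then int (ts ! nat i) else int n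
     else if A = ''u'' \<and> 0 \<le> i \<and> nat i \<in> I then 1
     else if A = ''b'' \<and> 0 \<le> i \<and> nat i \<in> set a then int (\<nu> (nat i)) else 0)" for A i
  have guessed: "guessed K \<sigma> (int j) \<longleftrightarrow> j \<in> T" if "j < n" for j
  proof
    assume "guessed K \<sigma> (int j)"
    then obtain k where "k < K" "\<sigma> ''t'' (int k) = int j" by (auto simp: guessed_def)
    thus "j \<in> T" using that by (auto simp: \<sigma>_def ts(1)[symmetric] split: if_splits)
  next
    assume "j \<in> T"
    then obtain k where "k < length ts" "ts ! k = j" unfolding ts(1)[symmetric] by (auto simp: in_set_conv_nth)
    thus "guessed K \<sigma> (int j)" using ts(2) T(2) unfolding guessed_def
      by (intro exI[of _ k]) (simp add: \<sigma>_def)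
  qed
  have wa: "weight_array n v (int j) = v $ j" if "j < n" for v j using that by (simp add: weight_array_def)
  have in_I: "1 \<le> \<sigma> ''u'' (int x) \<longleftrightarrow> x \<in> I" for x by (simp add: \<sigma>_def)
  have "query n m K w \<sigma> = preference T I"
    unfolding query_def preference_def
  proof (rule vec_eq_iff[THEN iffD2], intro conjI allI impI)
    fix j assume "j < dim_vec (vec n (\<lambda>j. int (if j \<in> T then 1 + m * n else if W j \<in> I then W j else 0)))"
    hence "j < n" by simp
    thus "vec n (\<lambda>j. query_entry n m K (weight_array n w) \<sigma> (int j)) $ j =
      vec n (\<lambda>j. int (if j \<in> T then 1 + m * n else if W j \<in> I then W j else 0)) $ j"
      using entry[of j] by (simp add: query_entry_def guessed wa in_I)
  qed simp
  note q = this
  let ?c = "candidate n m K lin w \<sigma>"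
  let ?y = "lin (preference T I)"
  have y: "dim_vec ?y = n" "?y $ j = 0 \<or> ?y $ j = 1" if "j < n" for j
    using S[OF lin_in_S] that by (auto simp: zero_one_vecs_def)
  have "?c $ j = 1 \<longleftrightarrow> j \<in> select T I \<nu>" if "j < n" for j
  proof -
    have "int j + 1 \<le> \<sigma> ''b'' (w $ j) \<longleftrightarrow> j < \<nu> (W j)"
      using entry[OF that] by (auto simp: \<sigma>_def)
    moreover have "j \<in> support ?y \<longleftrightarrow> 1 \<le> ?y $ j" using y[OF that] that by (auto simp: support_def)
    hence "j \<in> select T I \<nu> \<longleftrightarrow> 1 \<le> ?y $ j \<and> (W j \<in> I \<or> j \<in> T) \<and> j < \<nu> (W j)"
      by (simp add: select_def)
    moreover have "1 \<le> \<sigma> ''u'' (w $ j) \<longleftrightarrow> W j \<in> I" using entry[OF that] in_I by simp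
    ultimately show ?thesis using that
      by (auto simp: candidate_def chosen_def q wa guessed)
  qed
  moreover have "select T I \<nu> \<subseteq> {..<n}" using support_subset[OF lin_in_S] by (auto simp: select_def)
  ultimately have "support ?c = select T I \<nu>" by (auto simp: support_def candidate_def)
  hence "w \<bullet> ?c = int u" using value_eq_weight[OF candidate_in_S] u by simp
  moreover have "\<forall>(A, i)\<in>set (guess_cells a K). 0 \<le> \<sigma> A i \<and> \<sigma> A i \<le> int n"
  proof -
    have "ts ! k < n" if "k < length ts" for k using that ts(1) T(1) nth_mem by blast
    moreover have "n > 0" if "x \<in> I" for x using that I(2) by blast
    ultimately show ?thesis using \<nu> by (force simp: guess_cells_def \<sigma>_def less_imp_le Suc_le_eq)
  qed
  moreover have "\<forall>A\<in>{''t'', ''u'', ''b''}. \<forall>i. (A, i) \<notin> set (guess_cells a K) \<longrightarrow> \<sigma> A i = 0"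
  proof -
    have "(''t'', i) \<in> set (guess_cells a K)" if "0 \<le> i" "i < int K" for i
      using that by (auto simp: guess_cells_def image_iff intro!: bexI[of _ "nat i"])
    moreover have "(A, i) \<in> set (guess_cells a K)" if "A \<in> {''u'', ''b''}" "0 \<le> i" "nat i \<in> set a" for A i
      using that by (auto simp: guess_cells_def image_iff intro!: bexI[of _ "nat i"])
    ultimately show ?thesis using I(1) unfolding \<sigma>_def by auto
  qed
  ultimately show thesis using that by blast
qed

lemma sound_input: "sound (input_state n w)"
proof -
  have x: "get_vec n ''x'' (input_state n w) = 0\<^sub>v n"
    by (rule eq_vecI) (simp_all add: get_vec_def input_state_def)
  obtain y where y: "y \<in> S" using independence by (auto simp: independence_system_def)
  have "0\<^sub>v n \<le> y" using S[OF y] by (auto simp: less_eq_vec_def zero_one_vecs_def)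
  moreover have "0\<^sub>v n \<in> zero_one_vecs n" by (simp add: zero_one_vecs_def)
  ultimately have "0\<^sub>v n \<in> S" using y independence by (auto simp: independence_system_def)
  thus ?thesis unfolding sound_def x using w
    by (auto simp: input_state_def weight_array_def fun_eq_iff)
qed

lemma run_result:
  obtains k s where
    "run n lin (comparison_oracle f) (nested_loops (guess_cells a K) (test_guess m K)) (input_state n w) k s"
    "k \<le> nested_loops_time n (length (guess_cells a K))"
    "output_vec n s \<in> S" "\<And>u. u \<in> found \<Longrightarrow> f (w \<bullet> output_vec n s) \<le> f (int u)"
proof -
  let ?s0 = "input_state n w"
  have "distinct (guess_cells a K)"
    using a(1) by (auto simp: guess_cells_def distinct_map inj_on_def)
  moreover have "fst ` set (guess_cells a K) \<subseteq> {''t'', ''u'', ''b''}" by (auto simp: guess_cells_def)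
  moreover have zero: "arrays ?s0 A i = 0" if "A \<in> {''t'', ''u'', ''b''}" for A i
    using that by (auto simp: input_state_def)
  ultimately obtain k s where r:
    "run n lin (comparison_oracle f) (nested_loops (guess_cells a K) (test_guess m K)) ?s0 k s"
    "k \<le> nested_loops_time n (length (guess_cells a K))" "sound s"
    "\<forall>\<sigma>. (\<forall>(A, i)\<in>set (guess_cells a K). 0 \<le> \<sigma> A i \<and> \<sigma> A i \<le> int n) \<longrightarrow>
       (\<forall>A\<in>{''t'', ''u'', ''b''}. \<forall>i. (A, i) \<notin> set (guess_cells a K) \<longrightarrow> \<sigma> A i = arrays ?s0 A i) \<longrightarrow>
       f (vars s ''best'') \<le> f (w \<bullet> candidate n m K lin w \<sigma>)"
    using reaches_nested_loops[OF _ _ sound_input, of "guess_cells a K"] unfolding reaches_def by blast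
  have out: "output_vec n s \<in> S" "vars s ''best'' = w \<bullet> output_vec n s"
    using r(3) by (simp_all add: sound_def output_vec_def)
  show thesis
  proof (rule that[OF r(1,2) out(1)])
    fix u assume "u \<in> found"
    then obtain \<sigma> where \<sigma>: "\<forall>(A, i)\<in>set (guess_cells a K). 0 \<le> \<sigma> A i \<and> \<sigma> A i \<le> int n"
      "\<forall>A\<in>{''t'', ''u'', ''b''}. \<forall>i. (A, i) \<notin> set (guess_cells a K) \<longrightarrow> \<sigma> A i = 0"
      "w \<bullet> candidate n m K lin w \<sigma> = int u" by (rule found_is_candidate)
    have "\<forall>A\<in>{''t'', ''u'', ''b''}. \<forall>i. (A, i) \<notin> set (guess_cells a K) \<longrightarrow> \<sigma> A i = arrays ?s0 A i"
      using \<sigma>(2) zero by simp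
    from r(4)[rule_format, OF \<sigma>(1)[rule_format] this[rule_format]] 
    show "f (w \<bullet> output_vec n s) \<le> f (int u)" unfolding \<sigma>(3) out(2) by blast
  qed
qed

text \<open>A value better than \<open>f (w \<bullet> x')\<close> can only stem from a weight that no guess finds.\<close>

lemma better_values:
  assumes "\<And>u. u \<in> found \<Longrightarrow> f (w \<bullet> x') \<le> f (int u)"
  shows "finite {f (w \<bullet> x) | x. x \<in> S \<and> f (w \<bullet> x) < f (w \<bullet> x')}"
    and "card {f (w \<bullet> x) | x. x \<in> S \<and> f (w \<bullet> x) < f (w \<bullet> x')} \<le> r_value a"
proof -
  let ?V = "{f (w \<bullet> x) | x. x \<in> S \<and> f (w \<bullet> x) < f (w \<bullet> x')}"
  let ?M = "weight ` support ` S - found"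
  have "support ` S \<subseteq> Pow {..<n}" using support_subset by auto
  hence fin: "finite ?M" using finite_subset by (metis finite_Diff finite_Pow_iff finite_imageI finite_lessThan)
  have sub: "?V \<subseteq> (\<lambda>u. f (int u)) ` ?M"
  proof safe
    fix x assume x: "x \<in> S" "f (w \<bullet> x) < f (w \<bullet> x')"
    have "weight (support x) \<notin> found" using assms[of "weight (support x)"] x value_eq_weight[OF x(1)] by auto
    thus "f (w \<bullet> x) \<in> (\<lambda>u. f (int u)) ` ?M" using x value_eq_weight[OF x(1)] by auto
  qed
  thus "finite ?V" using fin finite_subset by blast
  have "card ?V \<le> card ((\<lambda>u. f (int u)) ` ?M)" using sub fin by (intro card_mono) auto
  also have "\<dots> \<le> card ?M" using fin by (rule card_image_le)
  also have "\<dots> \<le> r_value a" using a by (intro card_missed_le_r_value) (auto simp: m_def)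
  finally show "card ?V \<le> r_value a" .
qed

end

theorem theorem6p2:
  fixes a :: "nat list"
  assumes "primitive_tuple a"
  shows "\<exists>(P :: com) (q :: nat poly). \<forall>(n :: nat) (S :: int vec set) (w :: int vec)
           (f :: int \<Rightarrow> real) (lin :: int vec \<Rightarrow> int vec).
     independence_system n S \<longrightarrow> linear_optimization_oracle n S lin \<longrightarrow>
     w \<in> carrier_vec n \<longrightarrow> (\<forall>j<n. w $ j \<in> int ` set a) \<longrightarrow>
     (\<exists>k s. run n lin (comparison_oracle f) P (input_state n w) k s \<and>
        k \<le> poly q n \<and>
        r_best (r_value a) S w f (output_vec n s) \<and>
        ((\<forall>i. Suc i < length a \<longrightarrow> a ! i dvd a ! Suc i) \<longrightarrow>
           optimal_solution S w f (output_vec n s)) \<and>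
        (length a = 2 \<longrightarrow> r_best (frobenius a) S w f (output_vec n s)))"
proof -
  let ?m = "Max (set a)"
  let ?K = "length a * ?m"
  let ?P = "nested_loops (guess_cells a ?K) (test_guess ?m ?K)"
  obtain q where q: "\<And>n. nested_loops_time n (length (guess_cells a ?K)) = poly q n"
    using polynomially_nested_loops_time unfolding polynomially_def by metis
  show ?thesis
  proof (intro exI[of _ ?P] exI[of _ q] allI impI)
    fix n S w f lin
    assume "independence_system n S" "linear_optimization_oracle n S lin"
      "w \<in> carrier_vec n" "\<forall>j<n. w $ j \<in> int ` set a"
    then interpret problem_instance a n S w f lin
      using assms by unfold_locales
    obtain k s where r: "run n lin (comparison_oracle f)
        (nested_loops (guess_cells a K) (test_guess m K)) (input_state n w) k s"
        "k \<le> nested_loops_time n (length (guess_cells a K))"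
      and out: "output_vec n s \<in> S" "\<And>u. u \<in> found \<Longrightarrow> f (w \<bullet> output_vec n s) \<le> f (int u)"
      using run_result by blast
    let ?x = "output_vec n s"
    note V = better_values[OF out(2)]
    have r_best: "r_best (r_value a) S w f ?x" using out(1) V(2) by (simp add: r_best_def)
    have "optimal_solution S w f ?x" if "\<forall>i. Suc i < length a \<longrightarrow> a ! i dvd a ! Suc i"
    proof -
      have "card {f (w \<bullet> x) | x. x \<in> S \<and> f (w \<bullet> x) < f (w \<bullet> ?x)} = 0"
        using V(2) r_value_divisor_chain[OF assms that] by simp
      hence "{f (w \<bullet> x) | x. x \<in> S \<and> f (w \<bullet> x) < f (w \<bullet> ?x)} = {}" using V(1) by simp
      thus ?thesis using out(1) unfolding optimal_solution_def by (auto simp: not_less)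
    qed
    moreover have "r_best (frobenius a) S w f ?x" if "length a = 2"
      using r_best r_value_pair[OF assms that] by simp
    ultimately show "\<exists>k s. run n lin (comparison_oracle f) ?P (input_state n w) k s \<and>
        k \<le> poly q n \<and>
        r_best (r_value a) S w f (output_vec n s) \<and>
        ((\<forall>i. Suc i < length a \<longrightarrow> a ! i dvd a ! Suc i) \<longrightarrow>
           optimal_solution S w f (output_vec n s)) \<and>
        (length a = 2 \<longrightarrow> r_best (frobenius a) S w f (output_vec n s))"
      using r[unfolded K_def m_def q] r_best by (intro exI[of _ k] exI[of _ s]) blast
  qed
qed

end
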